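(* If $G$ is an infinite locally finite connected graph, then $G^2\square K_2$ has a Hamiltonian circle.
   Context: $G^2$ is the square of $G$: the graph on $V(G)$ with an edge between any two distinct vertices at distance at most 2 in $G$. $H\square K_2$ is the Cartesian product of $H$ with $K_2$. A ray is a one-way infinite path; two rays of a graph $H$ are equivalent if for every finite $S\subseteq V(H)$ some component of $H-S$ contains tails of both; the classes are the ends of $H$. For finite $S$ and an end $\alpha$, $C(S,\alpha)$ is the component of $H-S$ containing tails of rays of $\alpha$. The Freudenthal compactification $|H|$ of a locally finite graph $H$ is its 1-complex together with its ends, a basic open neighbourhood of an end $\alpha$ being, for finite $S$, the union of $C(S,\alpha)$, the ends whose rays have tails in $C(S,\alpha)$, and the inner points of edges between $S$ and $C(S,\alpha)$. A Hamiltonian circle of $H$ is the image of a homeomorphic embedding of $S^1$ into $|H|$ that contains every vertex of $H$. *)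

theory Defs
  imports "HOL-Analysis.Analysis"
begin

definition graph :: "'v set \<Rightarrow> ('v \<Rightarrow> 'v \<Rightarrow> bool) \<Rightarrow> bool" where
  "graph V E \<longleftrightarrow> (\<forall>u v. E u v \<longrightarrow> u \<in> V \<and> v \<in> V \<and> u \<noteq> v \<and> E v u)"

definition locally_finite :: "'v set \<Rightarrow> ('v \<Rightarrow> 'v \<Rightarrow> bool) \<Rightarrow> bool" where
  "locally_finite V E \<longleftrightarrow> (\<forall>v\<in>V. finite {u. E v u})"

definition connected_graph :: "'v set \<Rightarrow> ('v \<Rightarrow> 'v \<Rightarrow> bool) \<Rightarrow> bool" where
  "connected_graph V E \<longleftrightarrow> (\<forall>u\<in>V. \<forall>v\<in>V. (\<lambda>a b. E a b \<and> a \<in> V \<and> b \<in> V)\<^sup>*\<^sup>* u v)"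

definition graph_square :: "('v \<Rightarrow> 'v \<Rightarrow> bool) \<Rightarrow> 'v \<Rightarrow> 'v \<Rightarrow> bool" where
  "graph_square E u v \<longleftrightarrow> u \<noteq> v \<and> (E u v \<or> (\<exists>w. E u w \<and> E w v))"

(* Cartesian product H \<box> K_2, with V(K_2) = UNIV :: bool; vertex set V \<times> UNIV *)
definition box_K2 :: "'v set \<Rightarrow> ('v \<Rightarrow> 'v \<Rightarrow> bool) \<Rightarrow> ('v \<times> bool) \<Rightarrow> ('v \<times> bool) \<Rightarrow> bool" where
  "box_K2 V E x y \<longleftrightarrow>
     (snd x = snd y \<and> E (fst x) (fst y)) \<or> (fst x = fst y \<and> fst x \<in> V \<and> snd x \<noteq> snd y)"

definition ray :: "'v set \<Rightarrow> ('v \<Rightarrow> 'v \<Rightarrow> bool) \<Rightarrow> (nat \<Rightarrow> 'v) \<Rightarrow> bool" where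
  "ray V E r \<longleftrightarrow> inj r \<and> (\<forall>n. r n \<in> V \<and> E (r n) (r (Suc n)))"

(* x and y lie in the same component of H - S (both assumed outside S) *)
definition reach_avoid :: "'v set \<Rightarrow> ('v \<Rightarrow> 'v \<Rightarrow> bool) \<Rightarrow> 'v set \<Rightarrow> 'v \<Rightarrow> 'v \<Rightarrow> bool" where
  "reach_avoid V E S = (\<lambda>a b. E a b \<and> a \<in> V \<and> b \<in> V \<and> a \<notin> S \<and> b \<notin> S)\<^sup>*\<^sup>*"

definition equiv_rays :: "'v set \<Rightarrow> ('v \<Rightarrow> 'v \<Rightarrow> bool) \<Rightarrow> (nat \<Rightarrow> 'v) \<Rightarrow> (nat \<Rightarrow> 'v) \<Rightarrow> bool" where
  "equiv_rays V E r r' \<longleftrightarrow>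
     (\<forall>S. finite S \<and> S \<subseteq> V \<longrightarrow>
        (\<exists>n. \<forall>m\<ge>n. \<forall>k\<ge>n. r m \<notin> S \<and> r' k \<notin> S \<and> reach_avoid V E S (r m) (r' k)))"

definition ends :: "'v set \<Rightarrow> ('v \<Rightarrow> 'v \<Rightarrow> bool) \<Rightarrow> (nat \<Rightarrow> 'v) set set" where
  "ends V E = {{r'. ray V E r' \<and> equiv_rays V E r r'} | r. ray V E r}"

definition comp_end :: "'v set \<Rightarrow> ('v \<Rightarrow> 'v \<Rightarrow> bool) \<Rightarrow> 'v set \<Rightarrow> (nat \<Rightarrow> 'v) set \<Rightarrow> 'v set" where
  "comp_end V E S \<alpha> =
     {v \<in> V. v \<notin> S \<and> (\<exists>r\<in>\<alpha>. \<exists>n. \<forall>m\<ge>n. r m \<notin> S \<and> reach_avoid V E S v (r m))}"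

(* Points of |H|: points of the 1-complex are barycentric-coordinate functions
   (Inl), ends are Inr. *)
type_synonym 'v fpoint = "('v \<Rightarrow> real) + (nat \<Rightarrow> 'v) set"

definition vpt :: "'v \<Rightarrow> 'v fpoint" where
  "vpt v = Inl (\<lambda>x. if x = v then 1 else 0)"

definition ept :: "'v \<Rightarrow> 'v \<Rightarrow> real \<Rightarrow> 'v fpoint" where
  "ept u v t = Inl (\<lambda>x. if x = u then 1 - t else if x = v then t else 0)"

definition complex_points :: "'v set \<Rightarrow> ('v \<Rightarrow> 'v \<Rightarrow> bool) \<Rightarrow> 'v fpoint set" where
  "complex_points V E = vpt ` V \<union> {ept u v t | u v t. E u v \<and> 0 \<le> t \<and> t \<le> 1}"

definition complex_open :: "'v set \<Rightarrow> ('v \<Rightarrow> 'v \<Rightarrow> bool) \<Rightarrow> 'v fpoint set \<Rightarrow> bool" where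
  "complex_open V E U \<longleftrightarrow> U \<subseteq> complex_points V E \<and>
     (\<forall>u v. E u v \<longrightarrow> openin (top_of_set {0..1::real}) {t \<in> {0..1}. ept u v t \<in> U})"

definition end_nbhd :: "'v set \<Rightarrow> ('v \<Rightarrow> 'v \<Rightarrow> bool) \<Rightarrow> 'v set \<Rightarrow> (nat \<Rightarrow> 'v) set \<Rightarrow> 'v fpoint set" where
  "end_nbhd V E S \<alpha> =
     (let C = comp_end V E S \<alpha> in
        vpt ` C
      \<union> {ept u v t | u v t. E u v \<and> u \<in> C \<and> v \<in> C \<and> 0 \<le> t \<and> t \<le> 1}
      \<union> {Inr \<beta> | \<beta>. \<beta> \<in> ends V E \<and> (\<exists>r\<in>\<beta>. \<exists>n. \<forall>m\<ge>n. r m \<in> C)}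
      \<union> {ept u v t | u v t. E u v \<and> u \<in> S \<and> v \<in> C \<and> 0 < t \<and> t < 1})"

definition freudenthal :: "'v set \<Rightarrow> ('v \<Rightarrow> 'v \<Rightarrow> bool) \<Rightarrow> 'v fpoint topology" where
  "freudenthal V E =
     subtopology
       (topology_generated_by
          ({U. complex_open V E U} \<union>
           {end_nbhd V E S \<alpha> | S \<alpha>. finite S \<and> S \<subseteq> V \<and> \<alpha> \<in> ends V E}))
       (complex_points V E \<union> Inr ` ends V E)"

definition hamiltonian_circle :: "'v set \<Rightarrow> ('v \<Rightarrow> 'v \<Rightarrow> bool) \<Rightarrow> 'v fpoint set \<Rightarrow> bool" where
  "hamiltonian_circle V E C \<longleftrightarrow>
     (\<exists>f. embedding_map (top_of_set (sphere (0::complex) 1)) (freudenthal V E) f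
          \<and> C = f ` sphere 0 1)
     \<and> vpt ` V \<subseteq> C"

end

theory Submission
  imports Defs
begin

text \<open>
  Take a depth-first search tree of \<open>G\<close> whose roots approach a prescribed enumeration of the
  vertices, so that every branch leaves every vertex behind. Subtrees are connected and have finite
  edge boundary in \<open>G\<close>, hence in \<open>H = G\<^sup>2 \<box> K\<^sub>2\<close>; so branches of the tree converge to pairwise
  distinct ends of \<open>H\<close>. Recursively, for each subtree \<open>K\<close> with root \<open>v\<close>, there is a Hamiltonian path of
  \<open>K \<times> K\<^sub>2\<close> between the two copies of \<open>v\<close> that traverses each smaller subtree in one piece, using
  that siblings, as well as a vertex and its grandchildren, are adjacent in \<open>G\<^sup>2\<close>. The resulting scheme
  of nested refinements, read along binary expansions, is a continuous injection of the circle
  into the Hausdorff space \<open>|H|\<close>, and thus an embedding by compactness.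
\<close>

subsection \<open>The Freudenthal compactification\<close>

text \<open>The factor \<open>K_2\<close> gives every root two copies, so a subtree can be entered
  at one copy and left at the other. That a subtree is traversed in one piece is what makes the
  curve injective at ends: stretches with disjoint sets of inner vertices cannot contain the same
  end, since the rays of an end met by a stretch have tails among its inner vertices. Depth-first
  trees suit this because distinct components of \<open>K - v\<close> have no edges between them, so
  passing to a component adds only edges at \<open>v\<close> to the boundary. In an infinite graph
  such a search can run past a vertex forever; the choice of roots prevents that. Two obstacles
  shape the paths. Crossing a subtree between the copies of its root changes the level, so the
  parity of the number of children matters, and a second kind of traversal that keeps the level is
  required. Moreover, refining the first or last piece of a stretch again and again must end in an
  edge after finitely many steps; otherwise an end would sit where two stretches meet, and
  continuity there could not be checked on each side separately.\<close>

lemma graph_sym: "graph V E \<Longrightarrow> E u v \<Longrightarrow> E v u"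
  and graph_irrefl: "graph V E \<Longrightarrow> \<not> E u u"
  and graph_in: "graph V E \<Longrightarrow> E u v \<Longrightarrow> u \<in> V \<and> v \<in> V"
  by (auto simp: graph_def)

section \<open>Components outside a finite set and equivalence of rays\<close>

lemma reach_avoid_refl [simp]: "reach_avoid V E S x x"
  by (simp add: reach_avoid_def)

lemma reach_avoid_trans:
  "reach_avoid V E S x y \<Longrightarrow> reach_avoid V E S y z \<Longrightarrow> reach_avoid V E S x z"
  unfolding reach_avoid_def by (rule rtranclp_trans)

lemma reach_avoid_sym:
  assumes "graph V E" "reach_avoid V E S x y" shows "reach_avoid V E S y x"
proof -
  have "symp (\<lambda>a b. E a b \<and> a \<in> V \<and> b \<in> V \<and> a \<notin> S \<and> b \<notin> S)"
    using graph_sym[OF assms(1)] by (auto intro: sympI)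
  then show ?thesis
    using assms(2) unfolding reach_avoid_def by (meson sympD symp_rtranclp)
qed

lemma reach_avoid_edge:
  "graph V E \<Longrightarrow> E x y \<Longrightarrow> x \<notin> S \<Longrightarrow> y \<notin> S \<Longrightarrow> reach_avoid V E S x y"
  unfolding reach_avoid_def by (rule r_into_rtranclp) (auto simp: graph_def)

lemma comp_end_sub: "comp_end V E S \<alpha> \<subseteq> V - S"
  by (auto simp: comp_end_def)

lemma comp_end_reach:
  assumes "graph V E" "x \<in> comp_end V E S \<alpha>" "reach_avoid V E S x y"
  shows "y \<in> comp_end V E S \<alpha>"
proof -
  have x: "x \<in> V" "x \<notin> S" using assms(2) comp_end_sub by fast+
  have y: "y \<in> V \<and> y \<notin> S"
    using assms(3) unfolding reach_avoid_def by (induction rule: rtranclp_induct) (use x in auto)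
  obtain r n where r: "r \<in> \<alpha>" "\<forall>m\<ge>n. r m \<notin> S \<and> reach_avoid V E S x (r m)"
    using assms(2) unfolding comp_end_def by blast
  have "\<forall>m\<ge>n. r m \<notin> S \<and> reach_avoid V E S y (r m)"
    using r(2) reach_avoid_trans[OF reach_avoid_sym[OF assms(1,3)]] by simp
  then show ?thesis using r(1) y unfolding comp_end_def by blast
qed

lemma comp_end_edge:
  assumes "graph V E" "x \<in> comp_end V E S \<alpha>" "E x y"
  shows "y \<in> comp_end V E S \<alpha> \<or> y \<in> S"
proof (cases "y \<in> S")
  case False
  have "x \<notin> S" using assms(2) comp_end_sub by fast
  then show ?thesis
    using comp_end_reach[OF assms(1,2)] reach_avoid_edge[OF assms(1,3)] False by blast
qed simp

lemma equiv_raysD: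
  assumes "equiv_rays V E r r'" "finite S" "S \<subseteq> V"
  obtains n where "\<And>m k. n \<le> m \<Longrightarrow> n \<le> k \<Longrightarrow> r m \<notin> S \<and> r' k \<notin> S \<and> reach_avoid V E S (r m) (r' k)"
proof -
  have "\<exists>n. \<forall>m\<ge>n. \<forall>k\<ge>n. r m \<notin> S \<and> r' k \<notin> S \<and> reach_avoid V E S (r m) (r' k)"
    using assms by (simp add: equiv_rays_def)
  then show thesis using that by metis
qed

lemma equiv_raysI:
  assumes "\<And>S. finite S \<Longrightarrow> S \<subseteq> V \<Longrightarrow>
    \<exists>n. \<forall>m k. n \<le> m \<longrightarrow> n \<le> k \<longrightarrow> r m \<notin> S \<and> r' k \<notin> S \<and> reach_avoid V E S (r m) (r' k)"
  shows "equiv_rays V E r r'"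
  using assms unfolding equiv_rays_def by metis

lemma equiv_rays_sym:
  assumes g: "graph V E" and r: "equiv_rays V E r r'" shows "equiv_rays V E r' r"
proof (rule equiv_raysI)
  fix S assume "finite S" "S \<subseteq> V"
  then obtain n where n: "\<And>m k. n \<le> m \<Longrightarrow> n \<le> k \<Longrightarrow>
      r m \<notin> S \<and> r' k \<notin> S \<and> reach_avoid V E S (r m) (r' k)"
    by (rule equiv_raysD[OF r]) blast
  show "\<exists>n. \<forall>m k. n \<le> m \<longrightarrow> n \<le> k \<longrightarrow> r' m \<notin> S \<and> r k \<notin> S \<and> reach_avoid V E S (r' m) (r k)"
  proof (intro exI allI impI)
    fix m k assume "n \<le> m" "n \<le> k"
    then show "r' m \<notin> S \<and> r k \<notin> S \<and> reach_avoid V E S (r' m) (r k)"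
      using n[of k m] reach_avoid_sym[OF g] by simp
  qed
qed

lemma equiv_rays_trans:
  assumes "equiv_rays V E r r'" "equiv_rays V E r' r''" shows "equiv_rays V E r r''"
proof (rule equiv_raysI)
  fix S assume S: "finite S" "S \<subseteq> V"
  obtain n where n: "\<And>m k. n \<le> m \<Longrightarrow> n \<le> k \<Longrightarrow>
      r m \<notin> S \<and> r' k \<notin> S \<and> reach_avoid V E S (r m) (r' k)"
    by (rule equiv_raysD[OF assms(1) S]) blast
  obtain n' where n': "\<And>m k. n' \<le> m \<Longrightarrow> n' \<le> k \<Longrightarrow>
      r' m \<notin> S \<and> r'' k \<notin> S \<and> reach_avoid V E S (r' m) (r'' k)"
    by (rule equiv_raysD[OF assms(2) S]) blast
  show "\<exists>n. \<forall>m k. n \<le> m \<longrightarrow> n \<le> k \<longrightarrow> r m \<notin> S \<and> r'' k \<notin> S \<and> reach_avoid V E S (r m) (r'' k)"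
  proof (rule exI[of _ "max n n'"], intro allI impI)
    fix m k assume "max n n' \<le> m" "max n n' \<le> k"
    then have "r m \<notin> S \<and> r' (max n n') \<notin> S \<and> reach_avoid V E S (r m) (r' (max n n'))"
      "r' (max n n') \<notin> S \<and> r'' k \<notin> S \<and> reach_avoid V E S (r' (max n n')) (r'' k)"
      using n[of m "max n n'"] n'[of "max n n'" k] by simp_all
    then show "r m \<notin> S \<and> r'' k \<notin> S \<and> reach_avoid V E S (r m) (r'' k)"
      using reach_avoid_trans by metis
  qed
qed

lemma ends_equiv:
  assumes "graph V E" "\<alpha> \<in> ends V E" "r \<in> \<alpha>" "r' \<in> \<alpha>" shows "equiv_rays V E r r'"
proof -
  obtain a where "\<alpha> = {r'. ray V E r' \<and> equiv_rays V E a r'}"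
    using assms(2) unfolding ends_def by blast
  then have "equiv_rays V E a r" "equiv_rays V E a r'" using assms(3,4) by auto
  then show ?thesis using equiv_rays_sym[OF assms(1)] equiv_rays_trans by metis
qed

lemma ends_eqI:
  assumes g: "graph V E" and "\<alpha> \<in> ends V E" "\<beta> \<in> ends V E" "r \<in> \<alpha>" "r' \<in> \<beta>" "equiv_rays V E r r'"
  shows "\<alpha> = \<beta>"
proof -
  obtain a where a: "\<alpha> = {r'. ray V E r' \<and> equiv_rays V E a r'}"
    using assms(2) unfolding ends_def by blast
  obtain b where b: "\<beta> = {r'. ray V E r' \<and> equiv_rays V E b r'}"
    using assms(3) unfolding ends_def by blast
  have "equiv_rays V E a r" "equiv_rays V E b r'" using a b assms by auto
  then have "equiv_rays V E a b"
    using assms(6) equiv_rays_sym[OF g] equiv_rays_trans by metis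
  then have "equiv_rays V E a q \<longleftrightarrow> equiv_rays V E b q" for q
    using equiv_rays_sym[OF g] equiv_rays_trans by metis
  then show ?thesis using a b by simp
qed

text \<open>Barycentric coordinates: points of the 1-complex are told apart, and the traces of the
  basic neighbourhoods of ends on the 1-complex are described, by supports.\<close>

lemma ept_0 [simp]: "ept u v 0 = vpt u"
  by (auto simp: ept_def vpt_def)

lemma ept_1 [simp]: "u \<noteq> v \<Longrightarrow> ept u v 1 = vpt v"
  by (auto simp: ept_def vpt_def)

lemma vpt_eq_iff [simp]: "vpt u = vpt v \<longleftrightarrow> u = v"
  by (auto simp: vpt_def dest: fun_cong[of _ _ u] split: if_splits)

lemma vpt_ne_Inr [simp]: "vpt u \<noteq> Inr e" "Inr e \<noteq> vpt u"
  by (auto simp: vpt_def)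

lemma ept_ne_Inr [simp]: "ept u v t \<noteq> Inr e" "Inr e \<noteq> ept u v t"
  by (auto simp: ept_def)

lemma ept_inj: "u \<noteq> v \<Longrightarrow> ept u v t = ept u v s \<Longrightarrow> t = s"
  by (auto simp: ept_def dest: fun_cong[of _ _ v])

lemma complex_pointsE:
  assumes "p \<in> complex_points V E"
  obtains (vertex) v where "v \<in> V" "p = vpt v"
  | (edge) u v t where "E u v" "0 \<le> t" "t \<le> 1" "p = ept u v t"
  using assms unfolding complex_points_def by blast

lemma ept_in_complex [simp]:
  "E u v \<Longrightarrow> 0 \<le> t \<Longrightarrow> t \<le> 1 \<Longrightarrow> ept u v t \<in> complex_points V E"
  by (auto simp: complex_points_def)

lemma complex_points_support:
  assumes g: "graph V E" and p: "Inl p \<in> complex_points V E" and xy: "p x \<noteq> 0" "p y \<noteq> 0" "x \<noteq> y"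
  shows "E x y"
  using p
proof (cases rule: complex_pointsE)
  case (vertex v)
  then show ?thesis using xy by (auto simp: vpt_def split: if_splits)
next
  case (edge u v t)
  then have "p = (\<lambda>z. if z = u then 1 - t else if z = v then t else 0)" by (simp add: ept_def)
  then have "x = u \<and> y = v \<or> x = v \<and> y = u" using xy by (auto split: if_splits)
  then show ?thesis using edge(1) graph_sym[OF g edge(1)] by blast
qed

lemma ept_flip: "u \<noteq> v \<Longrightarrow> ept u v t = ept v u (1 - t)"
  by (auto simp: ept_def)

lemma end_nbhd_vptI: "v \<in> comp_end V E S \<alpha> \<Longrightarrow> vpt v \<in> end_nbhd V E S \<alpha>"
  by (simp add: end_nbhd_def Let_def)

lemma end_nbhd_eptI:
  assumes "E u v" "v \<in> comp_end V E S \<alpha>"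
    and "0 \<le> t \<and> t \<le> 1 \<and> u \<in> comp_end V E S \<alpha> \<or> 0 < t \<and> t < 1 \<and> u \<in> S"
  shows "ept u v t \<in> end_nbhd V E S \<alpha>"
  using assms(3)
proof
  assume "0 \<le> t \<and> t \<le> 1 \<and> u \<in> comp_end V E S \<alpha>"
  then have "ept u v t \<in> {ept u v t | u v t. E u v \<and> u \<in> comp_end V E S \<alpha> \<and>
      v \<in> comp_end V E S \<alpha> \<and> 0 \<le> t \<and> t \<le> 1}" using assms(1,2) by blast
  then show ?thesis unfolding end_nbhd_def Let_def by simp
next
  assume "0 < t \<and> t < 1 \<and> u \<in> S"
  then have "ept u v t \<in> {ept u v t | u v t. E u v \<and> u \<in> S \<and> v \<in> comp_end V E S \<alpha> \<and>
      0 < t \<and> t < 1}" using assms(1,2) by blast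
  then show ?thesis unfolding end_nbhd_def Let_def by simp
qed

lemma end_nbhdE:
  assumes "Inl p \<in> end_nbhd V E S \<alpha>"
  obtains (vertex) v where "v \<in> comp_end V E S \<alpha>" "Inl p = vpt v"
  | (edge) u v t where "E u v" "v \<in> comp_end V E S \<alpha>" "0 \<le> t" "t \<le> 1" "Inl p = ept u v t"
      "u \<in> comp_end V E S \<alpha> \<or> 0 < t"
proof -
  let ?C = "comp_end V E S \<alpha>"
  have "Inl p \<in> vpt ` ?C \<or> Inl p \<in> {ept u v t | u v t. E u v \<and> u \<in> ?C \<and> v \<in> ?C \<and> 0 \<le> t \<and> t \<le> 1}
    \<or> Inl p \<in> {ept u v t | u v t. E u v \<and> u \<in> S \<and> v \<in> ?C \<and> 0 < t \<and> t < 1}"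
    using assms unfolding end_nbhd_def Let_def by auto
  then show thesis
  proof (elim disjE)
    assume "Inl p \<in> {ept u v t | u v t. E u v \<and> u \<in> ?C \<and> v \<in> ?C \<and> 0 \<le> t \<and> t \<le> 1}"
    then show thesis using edge by blast
  next
    assume "Inl p \<in> {ept u v t | u v t. E u v \<and> u \<in> S \<and> v \<in> ?C \<and> 0 < t \<and> t < 1}"
    then obtain u v t where "E u v" "v \<in> ?C" "0 < t" "t < 1" "Inl p = ept u v t" by blast
    then show thesis using edge[of u v t] by simp
  qed (use vertex in blast)
qed

text \<open>All clauses of \<open>end_nbhd\<close> for points of the 1-complex collapse to one
  condition on the support. A neighbour of the component lies in it or in \<open>S\<close>, so every
  edge point with a nonzero coordinate in the component falls under one of the clauses; the bound
  \<open>0 < t\<close> discards the end vertex in \<open>S\<close>, whose support misses the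
  component.\<close>

lemma Inl_in_end_nbhd_iff:
  assumes g: "graph V E"
  shows "Inl p \<in> end_nbhd V E S \<alpha> \<longleftrightarrow>
    Inl p \<in> complex_points V E \<and> (\<exists>x \<in> comp_end V E S \<alpha>. p x \<noteq> 0)"
proof
  let ?C = "comp_end V E S \<alpha>"
  assume "Inl p \<in> end_nbhd V E S \<alpha>"
  then show "Inl p \<in> complex_points V E \<and> (\<exists>x \<in> ?C. p x \<noteq> 0)"
  proof (cases rule: end_nbhdE)
    case (vertex v)
    then have "p v \<noteq> 0" by (simp add: vpt_def)
    moreover have "v \<in> V" using vertex(1) comp_end_sub by fast
    ultimately show ?thesis using vertex by (auto simp: complex_points_def)
  next
    case (edge u v t)
    then have "u \<noteq> v" using graph_irrefl[OF g] by blast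
    then have "p u = 1 - t \<and> p v = t" using edge(5) by (simp add: ept_def)
    then have "\<exists>x \<in> ?C. p x \<noteq> 0" using edge(2,6) by (cases "t = 0") (auto intro: bexI[of _ u] bexI[of _ v])
    then show ?thesis using edge ept_in_complex[of E u v t] by simp
  qed
next
  let ?C = "comp_end V E S \<alpha>"
  assume a: "Inl p \<in> complex_points V E \<and> (\<exists>x \<in> ?C. p x \<noteq> 0)"
  then obtain x where x: "x \<in> ?C" "p x \<noteq> 0" by blast
  have vC: "vpt x \<in> end_nbhd V E S \<alpha>" by (rule end_nbhd_vptI[OF x(1)])
  have star: "ept x w t \<in> end_nbhd V E S \<alpha>" if "E x w" "0 \<le> t" "t < 1" for w t
  proof (cases "t = 0")
    case False
    have xw: "x \<noteq> w" using that graph_irrefl[OF g] by blast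
    have "E w x" using graph_sym[OF g] that(1) by blast
    moreover have "w \<in> ?C \<or> w \<in> S" using comp_end_edge[OF g x(1) that(1)] .
    ultimately have "ept w x (1 - t) \<in> end_nbhd V E S \<alpha>"
      using x(1) False that(2,3) by (intro end_nbhd_eptI) auto
    then show ?thesis using ept_flip[OF xw] by simp
  qed (use vC in simp)
  from a have "Inl p \<in> complex_points V E" by blast
  then show "Inl p \<in> end_nbhd V E S \<alpha>"
  proof (cases rule: complex_pointsE)
    case (vertex v)
    then have "p = (\<lambda>x. if x = v then 1 else 0)" by (simp add: vpt_def)
    then have "v = x" using x(2) by (auto split: if_splits)
    then show ?thesis using vC vertex by simp
  next
    case (edge u v t)
    then have p: "p = (\<lambda>x. if x = u then 1 - t else if x = v then t else 0)" by (simp add: ept_def)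
    have uv: "u \<noteq> v" using edge graph_irrefl[OF g] by blast
    show ?thesis
    proof (cases "x = u")
      case True
      then have "t < 1" using x(2) p edge by auto
      then show ?thesis using star edge True by simp
    next
      case False
      then have xv: "x = v" "t \<noteq> 0" using x(2) p by (auto split: if_splits)
      have "E v u" using graph_sym[OF g] edge by blast
      moreover have "0 \<le> 1 - t" "1 - t < 1" using edge xv by auto
      ultimately have "ept v u (1 - t) \<in> end_nbhd V E S \<alpha>"
        using star xv by simp
      then show ?thesis using ept_flip[OF uv] edge by simp
    qed
  qed
qed

lemma Inr_in_end_nbhd_iff:
  "Inr \<beta> \<in> end_nbhd V E S \<alpha> \<longleftrightarrow>
    \<beta> \<in> ends V E \<and> (\<exists>r\<in>\<beta>. \<exists>n. \<forall>m\<ge>n. r m \<in> comp_end V E S \<alpha>)"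
  unfolding end_nbhd_def Let_def by (auto simp: vpt_def ept_def)

section \<open>Open sets of the compactification\<close>

text \<open>A barycentric coordinate is continuous along each edge. Half-lines \<open>A\<close> will
  separate points in \<open>Hausdorff_freudenthal\<close>, and \<open>A = - {0}\<close> shows in
  \<open>near_leaf\<close> that neighbourhoods of ends have open traces on edges.\<close>

lemma complex_open_coordinate:
  assumes "open A"
  shows "complex_open V E {Inl p | p. Inl p \<in> complex_points V E \<and> p x \<in> A}"
  unfolding complex_open_def
proof (intro conjI allI impI)
  fix u v assume e: "E u v"
  let ?h = "\<lambda>t::real. if x = u then 1 - t else if x = v then t else 0"
  have "continuous_on {0..1} ?h" by (cases "x = u"; cases "x = v"; simp; intro continuous_intros)
  then have "openin (top_of_set {0..1}) ({0..1} \<inter> ?h -` A)"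
    using assms by (rule continuous_openin_preimage_gen)
  moreover have "{t \<in> {0..1}. ept u v t \<in> {Inl p |p. Inl p \<in> complex_points V E \<and> p x \<in> A}}
      = {0..1} \<inter> ?h -` A"
    using ept_in_complex[of E u v] e unfolding ept_def by auto
  ultimately show "openin (top_of_set {0..1})
      {t \<in> {0..1}. ept u v t \<in> {Inl p |p. Inl p \<in> complex_points V E \<and> p x \<in> A}}" by simp
qed auto

lemma ray_equiv_refl:
  assumes g: "graph V E" and r: "ray V E r" shows "equiv_rays V E r r"
proof (rule equiv_raysI)
  fix S assume "finite S" "S \<subseteq> V"
  then have "finite (r -` S)" using r by (simp add: ray_def finite_vimageI)
  then obtain n where "\<forall>m \<in> r -` S. m < n" using finite_nat_set_iff_bounded by blast
  then have n: "r m \<notin> S" if "n \<le> m" for m using that by (metis leD vimageI)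
  have up: "reach_avoid V E S (r m) (r (m + k))" if "n \<le> m" for m k
  proof (induction k)
    case (Suc k)
    have "reach_avoid V E S (r (m + k)) (r (Suc (m + k)))"
      by (rule reach_avoid_edge[OF g]) (use r n that in \<open>auto simp: ray_def\<close>)
    then show ?case using reach_avoid_trans[OF Suc] by simp
  qed simp
  have "reach_avoid V E S (r m) (r k)" if "n \<le> m" "n \<le> k" for m k
    using up[OF that(1), of "k - m"] reach_avoid_sym[OF g up[OF that(2), of "m - k"]]
    by (cases "m \<le> k") auto
  then show "\<exists>n. \<forall>m k. n \<le> m \<longrightarrow> n \<le> k \<longrightarrow> r m \<notin> S \<and> r k \<notin> S \<and> reach_avoid V E S (r m) (r k)"
    using n by blast
qed

lemma ends_ray: "\<alpha> \<in> ends V E \<Longrightarrow> r \<in> \<alpha> \<Longrightarrow> ray V E r"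
  unfolding ends_def by blast

lemma ends_nonempty: "graph V E \<Longrightarrow> \<alpha> \<in> ends V E \<Longrightarrow> \<exists>r. r \<in> \<alpha>"
  unfolding ends_def using ray_equiv_refl by blast

lemma end_tail_in_comp:
  assumes g: "graph V E" and "\<alpha> \<in> ends V E" "r \<in> \<alpha>" "finite S" "S \<subseteq> V"
  shows "\<exists>n. \<forall>m\<ge>n. r m \<in> comp_end V E S \<alpha>"
proof -
  have "equiv_rays V E r r" using ends_equiv[OF g] assms by blast
  then obtain n where "\<And>m k. n \<le> m \<Longrightarrow> n \<le> k \<Longrightarrow> r m \<notin> S \<and> r k \<notin> S \<and> reach_avoid V E S (r m) (r k)"
    using assms(4,5) by (rule equiv_raysD) blast
  moreover have "r m \<in> V" for m using ends_ray[OF assms(2,3)] by (simp add: ray_def)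
  ultimately show ?thesis using assms(3) unfolding comp_end_def by blast
qed

lemma complex_open_complex_points: "complex_open V E (complex_points V E)"
  unfolding complex_open_def
proof (intro conjI allI impI)
  fix u v assume "E u v"
  then have "{t \<in> {0..1}. ept u v t \<in> complex_points V E} = {0..1}" by auto
  then show "openin (top_of_set {0..1}) {t \<in> {0..1}. ept u v t \<in> complex_points V E}" by simp
qed simp

lemma end_in_nbhd:
  assumes "graph V E" "\<alpha> \<in> ends V E" "finite S" "S \<subseteq> V"
  shows "Inr \<alpha> \<in> end_nbhd V E S \<alpha>"
  unfolding Inr_in_end_nbhd_iff
  using assms ends_nonempty[OF assms(1,2)] end_tail_in_comp[OF assms(1,2)] by blast

abbreviation (input) freudenthal_basis :: "'v set \<Rightarrow> ('v \<Rightarrow> 'v \<Rightarrow> bool) \<Rightarrow> 'v fpoint set set" where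
  "freudenthal_basis V E \<equiv> {U. complex_open V E U} \<union>
     {end_nbhd V E S \<alpha> | S \<alpha>. finite S \<and> S \<subseteq> V \<and> \<alpha> \<in> ends V E}"

lemma topspace_freudenthal:
  assumes g: "graph V E"
  shows "topspace (freudenthal V E) = complex_points V E \<union> Inr ` ends V E"
proof -
  have "complex_points V E \<union> Inr ` ends V E \<subseteq> \<Union> (freudenthal_basis V E)"
    using complex_open_complex_points[of V E] end_in_nbhd[OF g, of _ "{}"] by blast
  then show ?thesis unfolding freudenthal_def topspace_subtopology topology_generated_by_topspace
    by blast
qed

lemma end_nbhd_sub:
  assumes "graph V E" shows "end_nbhd V E S \<alpha> \<subseteq> complex_points V E \<union> Inr ` ends V E"
proof
  fix p assume "p \<in> end_nbhd V E S \<alpha>"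
  then show "p \<in> complex_points V E \<union> Inr ` ends V E"
    by (cases p) (auto simp: Inl_in_end_nbhd_iff[OF assms] Inr_in_end_nbhd_iff)
qed

lemma openin_freudenthal_basis:
  assumes g: "graph V E" and "U \<in> freudenthal_basis V E"
  shows "openin (freudenthal V E) U"
proof -
  have "openin (topology_generated_by (freudenthal_basis V E)) U"
    by (rule topology_generated_by_Basis) (fact assms(2))
  moreover have "U \<subseteq> complex_points V E \<union> Inr ` ends V E"
    using assms(2) end_nbhd_sub[OF g] by (auto simp: complex_open_def)
  ultimately show ?thesis
    unfolding freudenthal_def openin_subtopology by blast
qed

lemma continuous_map_freudenthal:
  assumes g: "graph V E"
    and "\<And>U. U \<in> freudenthal_basis V E \<Longrightarrow> openin T {x \<in> topspace T. f x \<in> U}"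
    and "\<And>x. x \<in> topspace T \<Longrightarrow> f x \<in> complex_points V E \<union> Inr ` ends V E"
  shows "continuous_map T (freudenthal V E) f"
proof -
  have "f ` topspace T \<subseteq> \<Union> (freudenthal_basis V E)"
    using assms(3) topspace_freudenthal[OF g]
    unfolding freudenthal_def topspace_subtopology topology_generated_by_topspace by blast
  moreover have "openin T (f -` U \<inter> topspace T)" if "U \<in> freudenthal_basis V E" for U
    using assms(2)[OF that] by (simp add: vimage_def Collect_conj_eq Int_commute)
  ultimately have "continuous_map T (topology_generated_by (freudenthal_basis V E)) f"
    by (intro continuous_on_generated_topo) auto
  then show ?thesis
    unfolding freudenthal_def continuous_map_in_subtopology using assms(3) by auto
qed

section \<open>Separation of points and ends\<close>

text \<open>If the two components met for every finite \<open>S\<close>, a common vertex would link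
  tails of a ray of each end outside \<open>S\<close>, so the rays would be equivalent and the ends
  equal.\<close>

lemma end_comps_disjoint:
  assumes g: "graph V E" and e: "\<alpha> \<in> ends V E" "\<beta> \<in> ends V E" "\<alpha> \<noteq> \<beta>"
  shows "\<exists>S. finite S \<and> S \<subseteq> V \<and> comp_end V E S \<alpha> \<inter> comp_end V E S \<beta> = {}"
proof (rule ccontr)
  assume c: "\<not> ?thesis"
  obtain r r' where r: "r \<in> \<alpha>" "r' \<in> \<beta>" using ends_nonempty[OF g] e by blast
  have "equiv_rays V E r r'"
  proof (rule equiv_raysI)
    fix S assume S: "finite S" "S \<subseteq> V"
    then obtain v where v: "v \<in> comp_end V E S \<alpha>" "v \<in> comp_end V E S \<beta>" using c by blast
    have tail: "\<exists>n. \<forall>m\<ge>n. q m \<notin> S \<and> reach_avoid V E S v (q m)"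
      if h: "\<gamma> \<in> ends V E" "q \<in> \<gamma>" "v \<in> comp_end V E S \<gamma>" for q \<gamma>
    proof -
      obtain s n where s: "s \<in> \<gamma>" "\<forall>m\<ge>n. s m \<notin> S \<and> reach_avoid V E S v (s m)"
        using h(3) unfolding comp_end_def by blast
      obtain n' where n': "\<And>m k. n' \<le> m \<Longrightarrow> n' \<le> k \<Longrightarrow>
          s m \<notin> S \<and> q k \<notin> S \<and> reach_avoid V E S (s m) (q k)"
        using ends_equiv[OF g h(1) s(1) h(2)] S by (rule equiv_raysD) blast
      have "reach_avoid V E S v (s (max n n'))" using s(2) by simp
      moreover have "q m \<notin> S \<and> reach_avoid V E S (s (max n n')) (q m)" if "n' \<le> m" for m
        using n'[of "max n n'" m] that by simp
      ultimately have "\<forall>m\<ge>n'. q m \<notin> S \<and> reach_avoid V E S v (q m)"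
        using reach_avoid_trans by metis
      then show ?thesis by blast
    qed
    obtain n where n: "\<forall>m\<ge>n. r m \<notin> S \<and> reach_avoid V E S v (r m)"
      using tail[OF e(1) r(1) v(1)] by blast
    obtain n' where n': "\<forall>m\<ge>n'. r' m \<notin> S \<and> reach_avoid V E S v (r' m)"
      using tail[OF e(2) r(2) v(2)] by blast
    show "\<exists>n. \<forall>m k. n \<le> m \<longrightarrow> n \<le> k \<longrightarrow> r m \<notin> S \<and> r' k \<notin> S \<and> reach_avoid V E S (r m) (r' k)"
    proof (rule exI[of _ "max n n'"], intro allI impI)
      fix m k assume "max n n' \<le> m" "max n n' \<le> k"
      then have "r m \<notin> S \<and> reach_avoid V E S v (r m)" "r' k \<notin> S \<and> reach_avoid V E S v (r' k)"
        using n n' by simp_all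
      then show "r m \<notin> S \<and> r' k \<notin> S \<and> reach_avoid V E S (r m) (r' k)"
        using reach_avoid_trans[OF reach_avoid_sym[OF g], of S v "r m" "r' k"] by simp
    qed
  qed
  then show False using ends_eqI[OF g e(1,2) r] e(3) by blast
qed

lemma Hausdorff_freudenthal:
  assumes g: "graph V E" and lf: "locally_finite V E"
  shows "Hausdorff_space (freudenthal V E)"
proof -
  let ?T = "freudenthal V E"
  define sep where "sep p q \<longleftrightarrow> (\<exists>A B. openin ?T A \<and> openin ?T B \<and> p \<in> A \<and> q \<in> B \<and> disjnt A B)" for p q
  have sep_sym: "sep p q \<Longrightarrow> sep q p" for p q unfolding sep_def by (meson disjnt_sym)
  let ?co = "\<lambda>x A. {Inl p | p. Inl p \<in> complex_points V E \<and> p x \<in> A}"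
  have co: "openin ?T (?co x A)" if "open A" for x and A :: "real set"
    by (rule openin_freudenthal_basis[OF g]) (simp add: complex_open_coordinate[OF that])
  have en: "openin ?T (end_nbhd V E S \<alpha>)" if "finite S" "S \<subseteq> V" "\<alpha> \<in> ends V E" for S \<alpha>
    by (rule openin_freudenthal_basis[OF g]) (use that in blast)
  have lt: "sep (Inl p) (Inl q)"
    if pq: "Inl p \<in> complex_points V E" "Inl q \<in> complex_points V E" "p x < q x" for p q x
  proof -
    obtain c where c: "p x < c" "c < q x" using dense pq(3) by blast
    show ?thesis unfolding sep_def
      by (rule exI[of _ "?co x {..<c}"], rule exI[of _ "?co x {c<..}"])
        (use c pq co[of "{..<c}" x] co[of "{c<..}" x] in \<open>auto simp: disjnt_def\<close>)
  qed
  have mixed: "sep (Inl p) (Inr \<alpha>)" if p: "Inl p \<in> complex_points V E" and \<alpha>: "\<alpha> \<in> ends V E" for p \<alpha>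
  proof -
    have "\<exists>x \<in> V. p x > 0"
      using p
    proof (cases rule: complex_pointsE)
      case (vertex v)
      then show ?thesis by (intro bexI[of _ v]) (auto simp: vpt_def)
    next
      case (edge u v t)
      then have "u \<in> V" "v \<in> V" "u \<noteq> v" using graph_in[OF g] graph_irrefl[OF g] by blast+
      then show ?thesis using edge by (cases "t = 0") (auto simp: ept_def intro: bexI[of _ u] bexI[of _ v])
    qed
    then obtain x where x: "x \<in> V" "p x > 0" by blast
    \<comment> \<open>Deleting the closed neighbourhood of a support vertex \<open>x\<close> keeps
      the end away: a point near the end has a support vertex outside \<open>?S\<close>, and if
      \<open>x\<close> were in its support too, that vertex would be adjacent to \<open>x\<close>
      and so lie in \<open>?S\<close>.\<close>
    let ?S = "insert x {u. E x u}"
    have S: "finite ?S" "?S \<subseteq> V" using lf x(1) graph_in[OF g] by (auto simp: locally_finite_def)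
    have "q x \<le> 0" if qn: "Inl q \<in> end_nbhd V E ?S \<alpha>" for q
    proof (rule ccontr)
      assume q: "\<not> q x \<le> 0"
      obtain y where y: "y \<in> comp_end V E ?S \<alpha>" "q y \<noteq> 0" "Inl q \<in> complex_points V E"
        using qn unfolding Inl_in_end_nbhd_iff[OF g] by auto
      have "y \<notin> ?S" using y(1) comp_end_sub by fast
      moreover have "x \<noteq> y \<Longrightarrow> E x y" using complex_points_support[OF g y(3) _ y(2)] q by simp
      ultimately show False by blast
    qed
    then have "disjnt (?co x {0<..}) (end_nbhd V E ?S \<alpha>)" by (force simp: disjnt_def)
    then show ?thesis unfolding sep_def
      using co[of "{0<..}" x] en[OF S \<alpha>] end_in_nbhd[OF g \<alpha> S] p x(2)
      by (intro exI[of _ "?co x {0<..}"] exI[of _ "end_nbhd V E ?S \<alpha>"]) auto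
  qed
  have ee: "sep (Inr \<alpha>) (Inr \<beta>)" if \<alpha>: "\<alpha> \<in> ends V E" and \<beta>: "\<beta> \<in> ends V E" and ne: "\<alpha> \<noteq> \<beta>" for \<alpha> \<beta>
  proof -
    obtain S where S: "finite S" "S \<subseteq> V" "comp_end V E S \<alpha> \<inter> comp_end V E S \<beta> = {}"
      using end_comps_disjoint[OF g \<alpha> \<beta> ne] by blast
    have "z \<notin> end_nbhd V E S \<beta>" if z: "z \<in> end_nbhd V E S \<alpha>" for z
    proof
      assume z': "z \<in> end_nbhd V E S \<beta>"
      show False
      proof (cases z)
        case (Inl p)
        obtain x y where xy: "x \<in> comp_end V E S \<alpha>" "p x \<noteq> 0" "y \<in> comp_end V E S \<beta>" "p y \<noteq> 0"
          and p: "Inl p \<in> complex_points V E"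
          using z z' unfolding Inl Inl_in_end_nbhd_iff[OF g] by auto
        \<comment> \<open>The support vertices \<open>x\<close> and \<open>y\<close> span an edge
          outside \<open>S\<close>, which would join the two disjoint components.\<close>
        have "x \<noteq> y" using xy S(3) by blast
        have "E x y"
          using complex_points_support[OF g p xy(2,4)] \<open>x \<noteq> y\<close> .
        then show False
          using comp_end_edge[OF g xy(1)] xy(3) comp_end_sub[of V E S \<beta>] S(3) by blast
      next
        case (Inr \<gamma>)
        then obtain r n r' n' where r: "r \<in> \<gamma>" "\<forall>m\<ge>n. r m \<in> comp_end V E S \<alpha>"
          "r' \<in> \<gamma>" "\<forall>m\<ge>n'. r' m \<in> comp_end V E S \<beta>" and \<gamma>: "\<gamma> \<in> ends V E"
          using z z' unfolding Inr Inr_in_end_nbhd_iff by blast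
        obtain n'' where "\<And>m k. n'' \<le> m \<Longrightarrow> n'' \<le> k \<Longrightarrow>
            r m \<notin> S \<and> r' k \<notin> S \<and> reach_avoid V E S (r m) (r' k)"
          using ends_equiv[OF g \<gamma> r(1,3)] S(1,2) by (rule equiv_raysD) blast
        then have "reach_avoid V E S (r (max n n'')) (r' (max n' n''))" by simp
        then have "r' (max n' n'') \<in> comp_end V E S \<alpha>"
          using comp_end_reach[OF g] r(2) max.cobounded1 by blast
        then show False using r(4) S(3) max.cobounded1 by blast
      qed
    qed
    then have "disjnt (end_nbhd V E S \<alpha>) (end_nbhd V E S \<beta>)" by (auto simp: disjnt_def)
    then show ?thesis unfolding sep_def
      using en[OF S(1,2)] end_in_nbhd[OF g _ S(1,2)] \<alpha> \<beta> by blast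
  qed
  have cx: "Inr \<gamma> \<notin> complex_points V E" for \<gamma> by (auto simp: complex_points_def)
  have "sep p q" if pq: "p \<in> topspace ?T" "q \<in> topspace ?T" "p \<noteq> q" for p q
  proof -
    consider a b where "p = Inl a" "q = Inl b" | a \<beta> where "p = Inl a" "q = Inr \<beta>"
      | \<alpha> b where "p = Inr \<alpha>" "q = Inl b" | \<alpha> \<beta> where "p = Inr \<alpha>" "q = Inr \<beta>"
      by (cases p; cases q) auto
    then show ?thesis
    proof cases
      case (1 a b)
      then have m: "Inl a \<in> complex_points V E" "Inl b \<in> complex_points V E"
        using pq(1,2) by (auto simp: topspace_freudenthal[OF g])
      obtain x where "a x \<noteq> b x" using 1 pq(3) by blast
      then show ?thesis using lt[of a b x] lt[of b a x] m sep_sym 1 by fastforce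
    next
      case 2
      then show ?thesis using pq cx mixed by (auto simp: topspace_freudenthal[OF g])
    next
      case 3
      then show ?thesis using pq cx sep_sym[OF mixed] by (auto simp: topspace_freudenthal[OF g])
    next
      case 4
      then have "\<alpha> \<in> ends V E" "\<beta> \<in> ends V E" "\<alpha> \<noteq> \<beta>"
        using pq cx by (auto simp: topspace_freudenthal[OF g])
      then show ?thesis using ee 4 by simp
    qed
  qed
  then show ?thesis unfolding Hausdorff_space_def sep_def by blast
qed

subsection \<open>Circles from nested subdivisions\<close>

text \<open>Accessibility under iteration of \<open>nxt\<close>. The inductive form supplies the
  induction along leftmost and rightmost descents in \<open>curve_0\<close>, \<open>curve_1\<close>,
  \<open>near_0\<close> and \<open>near_1\<close>.\<close>

inductive terminates :: "('k \<Rightarrow> 'k option) \<Rightarrow> 'k \<Rightarrow> bool" for nxt where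
  terminatesI: "(\<And>k'. nxt k = Some k' \<Longrightarrow> terminates nxt k') \<Longrightarrow> terminates nxt k"

text \<open>A node \<open>k\<close> is a stretch of the circle from \<open>src k\<close> to \<open>tgt k\<close> with the set \<open>X k\<close> of inner vertices; it is
  an edge or is split at an inner vertex into two nodes. Splitting is matched with bisection of the
  parameter interval; vertices and edges sit at finite depth and ends at infinite branches. The two
  termination conditions keep ends off the dyadic parameters.\<close>

locale subdivision =
  fixes W :: "'w set" and F :: "'w \<Rightarrow> 'w \<Rightarrow> bool"
    and split :: "'k \<Rightarrow> ('k \<times> 'k) option" and src tgt :: "'k \<Rightarrow> 'w" and X :: "'k \<Rightarrow> 'w set"
    and good :: "'k \<Rightarrow> bool"
  assumes graph: "graph W F" and locally_finite: "locally_finite W F"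
    and good_split: "\<And>k k1 k2. good k \<Longrightarrow> split k = Some (k1, k2) \<Longrightarrow>
      good k1 \<and> good k2 \<and> src k1 = src k \<and> src k2 = tgt k1 \<and> tgt k2 = tgt k"
    and X_split: "\<And>k k1 k2. good k \<Longrightarrow> split k = Some (k1, k2) \<Longrightarrow>
      X k = insert (tgt k1) (X k1 \<union> X k2) \<and> X k1 \<inter> X k2 = {} \<and> tgt k1 \<notin> X k1 \<union> X k2"
    and good_leaf: "\<And>k. good k \<Longrightarrow> split k = None \<Longrightarrow> F (src k) (tgt k) \<and> X k = {}"
    and good_ends: "\<And>k. good k \<Longrightarrow>
      src k \<notin> X k \<and> tgt k \<notin> X k \<and> insert (src k) (insert (tgt k) (X k)) \<subseteq> W"
    and left_terminates: "\<And>k. good k \<Longrightarrow> terminates (\<lambda>k. map_option fst (split k)) k"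
    and right_terminates: "\<And>k. good k \<Longrightarrow> terminates (\<lambda>k. map_option snd (split k)) k"
    and finite_boundary: "\<And>k. good k \<Longrightarrow> finite {x \<in> X k. \<exists>y. F x y \<and> y \<notin> X k}"
    and branch: "\<And>\<kappa>. good (\<kappa> 0) \<Longrightarrow>
      (\<And>n. \<exists>k1 k2. split (\<kappa> n) = Some (k1, k2) \<and> \<kappa> (Suc n) \<in> {k1, k2}) \<Longrightarrow>
      \<exists>\<rho>. ray W F \<rho> \<and> (\<forall>n. \<exists>m\<ge>n. eventually (\<lambda>i. \<rho> i \<in> X (\<kappa> m)) sequentially) \<and>
        (\<forall>S. finite S \<longrightarrow> (\<exists>n Y. Y \<inter> S = {} \<and>
           insert (src (\<kappa> n)) (insert (tgt (\<kappa> n)) (X (\<kappa> n))) \<subseteq> Y \<and>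
           (\<forall>a\<in>Y. \<forall>b\<in>Y. reach_avoid W F S a b)))"
begin

section \<open>Binary walks and the ends of infinite branches\<close>

definition infinite_branch :: "(nat \<Rightarrow> 'k) \<Rightarrow> bool" where
  "infinite_branch \<kappa> \<longleftrightarrow> good (\<kappa> 0) \<and>
     (\<forall>n. \<exists>k1 k2. split (\<kappa> n) = Some (k1, k2) \<and> \<kappa> (Suc n) \<in> {k1, k2})"

definition END :: "(nat \<Rightarrow> 'k) \<Rightarrow> (nat \<Rightarrow> 'w) set" where
  "END \<kappa> = {r. ray W F r \<and> (\<forall>n. eventually (\<lambda>i. r i \<in> X (\<kappa> n)) sequentially)}"

text \<open>The doubling map on parameters. The midpoint goes to the left half, where it becomes
  parameter 1; leaves are fixed, so a walk stalls once it reaches one.\<close>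

definition step :: "'k \<times> real \<Rightarrow> 'k \<times> real" where
  "step p = (case split (fst p) of None \<Rightarrow> p
     | Some (k1, k2) \<Rightarrow> if snd p \<le> 1/2 then (k1, 2 * snd p) else (k2, 2 * snd p - 1))"

definition walk :: "'k \<Rightarrow> real \<Rightarrow> nat \<Rightarrow> 'k \<times> real" where
  "walk k t n = (step ^^ n) (k, t)"

definition stops :: "'k \<Rightarrow> real \<Rightarrow> bool" where
  "stops k t \<longleftrightarrow> (\<exists>n. split (fst (walk k t n)) = None)"

definition curve :: "'k \<Rightarrow> real \<Rightarrow> 'w fpoint" where
  "curve k t = (if stops k t
     then case walk k t (LEAST n. split (fst (walk k t n)) = None) of (k', t') \<Rightarrow> ept (src k') (tgt k') t'
     else Inr (END (\<lambda>n. fst (walk k t n))))"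

lemma walk_0 [simp]: "walk k t 0 = (k, t)"
  by (simp add: walk_def)

lemma walk_Suc: "walk k t (Suc n) = walk (fst (step (k, t))) (snd (step (k, t))) n"
  by (simp add: walk_def funpow_swap1)

lemma walk_Suc': "walk k t (Suc n) = step (walk k t n)"
  by (simp add: walk_def)

lemma infinite_branch_good: "infinite_branch \<kappa> \<Longrightarrow> good (\<kappa> n)"
proof (induction n)
  case (Suc n)
  then obtain k1 k2 where "split (\<kappa> n) = Some (k1, k2)" "\<kappa> (Suc n) \<in> {k1, k2}"
    unfolding infinite_branch_def by blast
  then show ?case using good_split[of "\<kappa> n" k1 k2] Suc by auto
qed (simp add: infinite_branch_def)

lemma infinite_branch_X_Suc: "infinite_branch \<kappa> \<Longrightarrow> X (\<kappa> (Suc n)) \<subseteq> X (\<kappa> n)"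
proof -
  assume br: "infinite_branch \<kappa>"
  then obtain k1 k2 where "split (\<kappa> n) = Some (k1, k2)" "\<kappa> (Suc n) \<in> {k1, k2}"
    unfolding infinite_branch_def by blast
  then show ?thesis using X_split[OF infinite_branch_good[OF br, of n]] by blast
qed

lemma infinite_branch_X: "infinite_branch \<kappa> \<Longrightarrow> n \<le> m \<Longrightarrow> X (\<kappa> m) \<subseteq> X (\<kappa> n)"
  by (rule lift_Suc_antimono_le) (rule infinite_branch_X_Suc)

lemma END_shift:
  assumes "infinite_branch \<kappa>" shows "END (\<lambda>n. \<kappa> (Suc n)) = END \<kappa>"
proof -
  have "eventually (\<lambda>i. r i \<in> X (\<kappa> n)) sequentially"
    if "eventually (\<lambda>i. r i \<in> X (\<kappa> (Suc n))) sequentially" for r n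
    using that by (rule eventually_mono) (use infinite_branch_X_Suc[OF assms] in blast)
  then show ?thesis unfolding END_def by blast
qed

lemma branch_ray:
  assumes "infinite_branch \<kappa>"
  obtains \<rho> where "\<rho> \<in> END \<kappa>"
    "\<And>S. finite S \<Longrightarrow> \<exists>n Y. Y \<inter> S = {} \<and>
           insert (src (\<kappa> n)) (insert (tgt (\<kappa> n)) (X (\<kappa> n))) \<subseteq> Y \<and>
           (\<forall>a\<in>Y. \<forall>b\<in>Y. reach_avoid W F S a b)"
proof -
  obtain \<rho> where \<rho>: "ray W F \<rho>" "\<And>n. \<exists>m\<ge>n. eventually (\<lambda>i. \<rho> i \<in> X (\<kappa> m)) sequentially"
    and conn: "\<And>S. finite S \<Longrightarrow> \<exists>n Y. Y \<inter> S = {} \<and>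
           insert (src (\<kappa> n)) (insert (tgt (\<kappa> n)) (X (\<kappa> n))) \<subseteq> Y \<and>
           (\<forall>a\<in>Y. \<forall>b\<in>Y. reach_avoid W F S a b)"
    using branch[of \<kappa>] assms unfolding infinite_branch_def by blast
  have "eventually (\<lambda>i. \<rho> i \<in> X (\<kappa> n)) sequentially" for n
  proof -
    obtain m where "n \<le> m" "eventually (\<lambda>i. \<rho> i \<in> X (\<kappa> m)) sequentially" using \<rho>(2) by blast
    then show ?thesis using infinite_branch_X[OF assms, of n m] by (auto elim: eventually_mono)
  qed
  then have "\<rho> \<in> END \<kappa>" using \<rho>(1) by (simp add: END_def)
  then show thesis using conn by (rule that)
qed

text \<open>Rays with tails in all nodes of the branch are joined outside \<open>S\<close> by the
  connected set that \<open>branch_ray\<close> provides around some node. Conversely, finite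
  boundaries force a ray equivalent to one of them into every node.\<close>

lemma END_in_ends:
  assumes br: "infinite_branch \<kappa>" shows "END \<kappa> \<in> ends W F"
proof -
  obtain \<rho> where \<rho>: "\<rho> \<in> END \<kappa>"
    and conn: "\<And>S. finite S \<Longrightarrow> \<exists>n Y. Y \<inter> S = {} \<and>
           insert (src (\<kappa> n)) (insert (tgt (\<kappa> n)) (X (\<kappa> n))) \<subseteq> Y \<and>
           (\<forall>a\<in>Y. \<forall>b\<in>Y. reach_avoid W F S a b)"
    using branch_ray[OF br] by metis
  have ray: "ray W F \<rho>" using \<rho> by (simp add: END_def)
  have "r \<in> END \<kappa> \<longleftrightarrow> equiv_rays W F \<rho> r" if r: "ray W F r" for r
  proof
    assume rE: "r \<in> END \<kappa>"
    show "equiv_rays W F \<rho> r"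
    proof (rule equiv_raysI)
      fix S assume "finite S" "S \<subseteq> W"
      then obtain n Y where Y: "Y \<inter> S = {}" "X (\<kappa> n) \<subseteq> Y" "\<forall>a\<in>Y. \<forall>b\<in>Y. reach_avoid W F S a b"
        using conn[of S] by blast
      have "eventually (\<lambda>i. \<rho> i \<in> X (\<kappa> n) \<and> r i \<in> X (\<kappa> n)) sequentially"
        using \<rho> rE by (simp add: END_def eventually_conj_iff)
      then obtain N where "\<And>i. N \<le> i \<Longrightarrow> \<rho> i \<in> X (\<kappa> n) \<and> r i \<in> X (\<kappa> n)"
        unfolding eventually_sequentially by blast
      then have "\<And>i. N \<le> i \<Longrightarrow> \<rho> i \<in> Y \<and> r i \<in> Y" using Y(2) by blast
      then show "\<exists>n. \<forall>m k. n \<le> m \<longrightarrow> n \<le> k \<longrightarrow>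
          \<rho> m \<notin> S \<and> r k \<notin> S \<and> reach_avoid W F S (\<rho> m) (r k)"
        using Y(1,3) by blast
    qed
  next
    assume eq: "equiv_rays W F \<rho> r"
    have "eventually (\<lambda>i. r i \<in> X (\<kappa> n)) sequentially" for n
    proof -
      \<comment> \<open>\<open>?S\<close> is the inner boundary of the node: a path that starts in
        \<open>?X\<close> and avoids \<open>?S\<close> has no vertex from which it could leave
        \<open>?X\<close>.\<close>
      let ?X = "X (\<kappa> n)" and ?S = "{x \<in> X (\<kappa> n). \<exists>y. F x y \<and> y \<notin> X (\<kappa> n)}"
      have "finite ?S" "?S \<subseteq> W"
        using finite_boundary good_ends infinite_branch_good[OF br, of n] by blast+
      then obtain N where N: "\<And>m k. N \<le> m \<Longrightarrow> N \<le> k \<Longrightarrow>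
          \<rho> m \<notin> ?S \<and> r k \<notin> ?S \<and> reach_avoid W F ?S (\<rho> m) (r k)"
        by (rule equiv_raysD[OF eq]) blast
      have "eventually (\<lambda>i. \<rho> i \<in> ?X) sequentially" using \<rho> by (simp add: END_def)
      then obtain M where M: "\<And>i. M \<le> i \<Longrightarrow> \<rho> i \<in> ?X"
        unfolding eventually_sequentially by blast
      have closed: "b \<in> ?X" if "reach_avoid W F ?S a b" "a \<in> ?X" for a b
        using that(1) unfolding reach_avoid_def
        by (induction rule: rtranclp_induct) (use that(2) in auto)
      have "r k \<in> ?X" if "N \<le> k" for k
        using closed[of "\<rho> (max N M)" "r k"] N[of "max N M" k] M[of "max N M"] that by simp
      then show ?thesis unfolding eventually_sequentially by blast
    qed
    then show "r \<in> END \<kappa>" using r by (simp add: END_def)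
  qed
  then have "END \<kappa> = {r. ray W F r \<and> equiv_rays W F \<rho> r}" by (auto simp: END_def)
  then show ?thesis using ray unfolding ends_def by blast
qed

lemma stops_leaf: "split k = None \<Longrightarrow> stops k t"
  unfolding stops_def by (rule exI[of _ 0]) simp

lemma stops_split:
  assumes "split k = Some (k1, k2)"
  shows "stops k t \<longleftrightarrow> (if t \<le> 1/2 then stops k1 (2 * t) else stops k2 (2 * t - 1))"
proof -
  have "stops k t \<longleftrightarrow> (\<exists>n. split (fst (walk k t (Suc n))) = None)"
    unfolding stops_def using assms by (metis fst_conv not0_implies_Suc option.distinct(1) walk_0)
  then show ?thesis using assms by (simp add: stops_def walk_Suc step_def)
qed

lemma stops_induct [consumes 2, case_names leaf split]:
  assumes "stops k t" "good k"
    and leaf: "\<And>k t. good k \<Longrightarrow> split k = None \<Longrightarrow> P k t"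
    and split: "\<And>k k1 k2 t. good k \<Longrightarrow> split k = Some (k1, k2) \<Longrightarrow>
      (t \<le> 1/2 \<Longrightarrow> P k1 (2 * t)) \<Longrightarrow> (1/2 < t \<Longrightarrow> P k2 (2 * t - 1)) \<Longrightarrow> P k t"
  shows "P k t"
proof -
  obtain n where "split (fst (walk k t n)) = None" using assms(1) stops_def by blast
  then show ?thesis using \<open>good k\<close>
  proof (induction n arbitrary: k t)
    case (Suc n)
    show ?case
    proof (cases "split k")
      case (Some a)
      then obtain k1 k2 where s: "split k = Some (k1, k2)" by (cases a) auto
      show ?thesis
        by (rule split[OF Suc.prems(2) s])
          (use Suc good_split[OF Suc.prems(2) s] s in \<open>auto simp: walk_Suc step_def\<close>)
    qed (use leaf Suc.prems in blast)
  qed (use leaf in simp)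
qed

lemma walk_branch:
  assumes "\<not> stops k t" "good k"
  shows "infinite_branch (\<lambda>n. fst (walk k t n))"
  unfolding infinite_branch_def
proof (intro conjI allI)
  fix n
  obtain k1 k2 where "split (fst (walk k t n)) = Some (k1, k2)"
    using assms(1) unfolding stops_def by (metis not_None_eq surj_pair)
  then show "\<exists>k1 k2. split (fst (walk k t n)) = Some (k1, k2) \<and> fst (walk k t (Suc n)) \<in> {k1, k2}"
    by (auto simp: walk_Suc' step_def)
qed (use assms in simp)

section \<open>Recursion, supports and endpoints of the curve\<close>

lemma curve_leaf: "split k = None \<Longrightarrow> curve k t = ept (src k) (tgt k) t"
  unfolding curve_def using stops_leaf by simp

lemma curve_split:
  assumes g: "good k" and s: "split k = Some (k1, k2)"
  shows "curve k t = (if t \<le> 1/2 then curve k1 (2 * t) else curve k2 (2 * t - 1))"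
proof -
  obtain k' t' where k': "step (k, t) = (k', t')" by fastforce
  then have w: "walk k t (Suc n) = walk k' t' n" for n by (simp add: walk_Suc)
  have k't': "if t \<le> 1/2 then k' = k1 \<and> t' = 2 * t else k' = k2 \<and> t' = 2 * t - 1"
    using k' s by (auto simp: step_def split: if_splits)
  have st: "stops k t \<longleftrightarrow> stops k' t'" using stops_split[OF s, of t] k't' by presburger
  have "curve k t = curve k' t'"
  proof (cases "stops k t")
    case True
    then obtain n where "split (fst (walk k t n)) = None" using stops_def by blast
    then have "(LEAST n. split (fst (walk k t n)) = None)
        = Suc (LEAST n. split (fst (walk k t (Suc n))) = None)"
      by (rule Least_Suc) (simp add: s)
    then show ?thesis using True st by (simp add: curve_def w)
  next
    case False
    then show ?thesis using st END_shift[OF walk_branch[OF False g]] by (simp add: curve_def w)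
  qed
  then show ?thesis using k't' by presburger
qed

lemma curve_nonstop: "\<not> stops k t \<Longrightarrow> curve k t = Inr (END (\<lambda>n. fst (walk k t n)))"
  by (simp add: curve_def)

lemma curve_Inl_stops: "curve k t = Inl p \<Longrightarrow> stops k t"
  using curve_nonstop by fastforce

lemma good_walk: "good k \<Longrightarrow> good (fst (walk k t n))"
proof (induction n)
  case (Suc n)
  then have g: "good (fst (walk k t n))" by blast
  show ?case
  proof (cases "split (fst (walk k t n))")
    case (Some a)
    then obtain k1 k2 where "split (fst (walk k t n)) = Some (k1, k2)" by (cases a) auto
    then show ?thesis using good_split[OF g] by (simp add: walk_Suc' step_def)
  qed (simp add: walk_Suc' step_def g)
qed simp

text \<open>The halves of a node are separated by supports: a point of the 1-complex on the curve of a
  node that is not a real edge has an interior vertex of that node in its support.\<close>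

lemma curve_support:
  assumes "good k" "curve k t = Inl p" "0 \<le> t" "t \<le> 1"
  shows "Inl p \<in> complex_points W F \<and> {x. p x \<noteq> 0} \<subseteq> insert (src k) (insert (tgt k) (X k))"
  using curve_Inl_stops[OF assms(2)] assms
proof (induction rule: stops_induct)
  case (leaf k t)
  then have "Inl p = ept (src k) (tgt k) t" by (simp add: curve_leaf)
  then show ?case using leaf good_leaf[OF leaf(1,2)] ept_in_complex[of F "src k" "tgt k" t W]
    by (auto simp: ept_def split: if_splits)
next
  case (split k k1 k2 t)
  note gs = good_split[OF split(1,2)] X_split[OF split(1,2)]
  show ?case
  proof (cases "t \<le> 1/2")
    case True
    then show ?thesis using split.IH(1) split.prems gs by (auto simp: curve_split[OF split(1,2)])
  next
    case False
    then show ?thesis using split.IH(2) split.prems gs by (auto simp: curve_split[OF split(1,2)])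
  qed
qed

lemma curve_end:
  assumes "good k" "curve k t = Inr \<beta>"
  shows "\<beta> \<in> ends W F" "\<exists>r \<in> \<beta>. eventually (\<lambda>i. r i \<in> X k) sequentially"
    "r \<in> \<beta> \<Longrightarrow> eventually (\<lambda>i. r i \<in> X k) sequentially"
proof -
  let ?\<kappa> = "\<lambda>n. fst (walk k t n)"
  have ns: "\<not> stops k t" using assms(2) by (auto simp: curve_def split: prod.splits if_splits)
  then have b: "\<beta> = END ?\<kappa>" using assms(2) curve_nonstop by simp
  have br: "infinite_branch ?\<kappa>" by (rule walk_branch[OF ns assms(1)])
  show "\<beta> \<in> ends W F" using END_in_ends[OF br] b by simp
  show ev: "eventually (\<lambda>i. r i \<in> X k) sequentially" if "r \<in> \<beta>" for r
    using that b by (auto simp: END_def dest: spec[of _ 0])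
  show "\<exists>r \<in> \<beta>. eventually (\<lambda>i. r i \<in> X k) sequentially"
    using branch_ray[OF br] b ev by metis
qed

lemma curve_0: "good k \<Longrightarrow> curve k 0 = vpt (src k)"
proof -
  assume g: "good k"
  show ?thesis using left_terminates[OF g] g
  proof (induction rule: terminates.induct)
    case (terminatesI k)
    show ?case
    proof (cases "split k")
      case None then show ?thesis by (simp add: curve_leaf)
    next
      case (Some a)
      then obtain k1 k2 where s: "split k = Some (k1, k2)" by (cases a) auto
      show ?thesis using terminatesI.IH[of k1] s good_split[OF terminatesI.prems s]
        by (simp add: curve_split[OF terminatesI.prems s])
    qed
  qed
qed

lemma curve_1: "good k \<Longrightarrow> curve k 1 = vpt (tgt k)"
proof -
  assume g: "good k"
  show ?thesis using right_terminates[OF g] g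
  proof (induction rule: terminates.induct)
    case (terminatesI k)
    show ?case
    proof (cases "split k")
      case None
      then have "src k \<noteq> tgt k" using good_leaf[OF terminatesI.prems] graph_irrefl[OF graph] by metis
      then show ?thesis using None by (simp add: curve_leaf)
    next
      case (Some a)
      then obtain k1 k2 where s: "split k = Some (k1, k2)" by (cases a) auto
      show ?thesis using terminatesI.IH[of k2] s good_split[OF terminatesI.prems s]
        by (simp add: curve_split[OF terminatesI.prems s])
    qed
  qed
qed

lemma curve_half: "good k \<Longrightarrow> split k = Some (k1, k2) \<Longrightarrow> curve k (1/2) = vpt (tgt k1)"
  using curve_split[of k k1 k2 "1/2"] curve_1[of k1] good_split[of k k1 k2] by simp

section \<open>Injectivity of the curve and coverage of the vertices\<close>

text \<open>The split vertex is an inner vertex of \<open>k\<close>, hence neither of its endpoints.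
  So only an outermost node can be a closed stretch, and the nondegeneracy condition of the
  injectivity lemmas passes to both halves.\<close>

lemma child_ends_distinct:
  assumes "good k" "split k = Some (k1, k2)"
  shows "src k1 \<noteq> tgt k1" "src k2 \<noteq> tgt k2"
  using good_split[OF assms] X_split[OF assms] good_ends[OF assms(1)] by auto

lemma curve_support_interior:
  assumes "good k" "curve k t = Inl p" "0 < t" "t < 1" "split k \<noteq> None"
  shows "\<exists>x \<in> X k. p x \<noteq> 0"
  using curve_Inl_stops[OF assms(2)] assms
proof (induction rule: stops_induct)
  case (split k k1 k2 t)
  note gs = good_split[OF split(1,2)] X_split[OF split(1,2)]
  \<comment> \<open>For a half that is an edge, one end vertex is the split vertex, which lies in
    \<open>X k\<close>, and an inner point of the edge has both coordinates nonzero.\<close>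
  have leaf: "\<exists>x \<in> X k. p x \<noteq> 0"
    if "good k'" "split k' = None" "ept (src k') (tgt k') t' = Inl p" "0 < t'" "t' < 1"
      "src k' \<in> X k \<or> tgt k' \<in> X k" for k' t'
  proof -
    have "src k' \<noteq> tgt k'" using good_leaf[OF that(1,2)] graph_irrefl[OF graph] by metis
    then have "p (src k') = 1 - t'" "p (tgt k') = t'" using that(3) by (auto simp: ept_def)
    then show ?thesis using that(4-6) by (metis diff_gt_0_iff_gt less_irrefl)
  qed
  consider "t < 1/2" | "t = 1/2" | "t > 1/2" by linarith
  then show ?case
  proof cases
    case 1
    then have c: "curve k1 (2 * t) = Inl p" using split.prems curve_split[OF split(1,2)] by simp
    show ?thesis
    proof (cases "split k1")
      case None
      then show ?thesis using leaf[of k1 "2 * t"] gs c 1 split.prems by (simp add: curve_leaf)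
    qed (use split.IH(1) 1 c gs split.prems in auto)
  next
    case 2
    then have "vpt (tgt k1) = Inl p" using split.prems(1) curve_half[OF split(1,2)] by metis
    then show ?thesis using gs by (intro bexI[of _ "tgt k1"]) (auto simp: vpt_def)
  next
    case 3
    then have c: "curve k2 (2 * t - 1) = Inl p" using split.prems curve_split[OF split(1,2)] by simp
    show ?thesis
    proof (cases "split k2")
      case None
      then show ?thesis using leaf[of k2 "2 * t - 1"] gs c 3 split.prems by (simp add: curve_leaf)
    qed (use split.IH(2) 3 c gs split.prems in auto)
  qed
qed simp

lemma curve_interior_ne_vertex:
  assumes g: "good k" and t: "0 < t" "t < 1" and x: "x \<in> {src k, tgt k}"
  shows "curve k t \<noteq> vpt x"
proof
  assume c: "curve k t = vpt x"
  show False
  proof (cases "split k")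
    case None
    have ne: "src k \<noteq> tgt k" using good_leaf[OF g None] graph_irrefl[OF graph] by metis
    have "ept (src k) (tgt k) t = vpt x" using c None by (simp add: curve_leaf)
    then have "ept (src k) (tgt k) t = ept (src k) (tgt k) 0 \<or> ept (src k) (tgt k) t = ept (src k) (tgt k) 1"
      using x ne by auto
    then show False using ept_inj[OF ne] t by fastforce
  next
    case (Some a)
    then obtain y where "y \<in> X k" "(if y = x then 1 else 0) \<noteq> (0::real)"
      using curve_support_interior[OF g _ t, of "\<lambda>y. if y = x then 1 else 0"] c
      by (auto simp: vpt_def)
    then have "x \<in> X k" by (auto split: if_splits)
    then show False using good_ends[OF g] x by blast
  qed
qed

text \<open>Inner vertices in the support tell the halves apart as soon as one half is split again,
  and an end common to both would have a ray with tails in two disjoint sets. If both halves are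
  edges, they could be one edge run forth and back; the condition on \<open>src k\<close>,
  \<open>tgt k\<close> and \<open>X k\<close> excludes this.\<close>

lemma curve_halves_disjoint:
  assumes g: "good k" and s: "split k = Some (k1, k2)"
    and nd: "src k \<noteq> tgt k \<or> X k \<noteq> {tgt k1}"
    and t: "0 < t" "t < 1" "0 < u" "u < 1"
  shows "curve k1 t \<noteq> curve k2 u"
proof
  assume eq: "curve k1 t = curve k2 u"
  note gs = good_split[OF g s] and Xs = X_split[OF g s]
  have g1: "good k1" and g2: "good k2" using gs by auto
  have e: "src k1 \<notin> X k1" "tgt k1 \<notin> X k1" "src k2 \<notin> X k2" "tgt k2 \<notin> X k2" "src k1 \<notin> X k2" "tgt k2 \<notin> X k1"
    using good_ends[OF g1] good_ends[OF g2] good_ends[OF g] gs Xs by auto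
  show False
  proof (cases "curve k1 t")
    case (Inl p)
    have c1: "curve k1 t = Inl p" and c2: "curve k2 u = Inl p" using Inl eq by auto
    have s1: "{x. p x \<noteq> 0} \<subseteq> insert (src k1) (insert (tgt k1) (X k1))"
      using curve_support[OF g1 c1] t by simp
    have s2: "{x. p x \<noteq> 0} \<subseteq> insert (src k2) (insert (tgt k2) (X k2))"
      using curve_support[OF g2 c2] t by simp
    show False
    proof (cases "split k1 = None \<and> split k2 = None")
      case False
      then consider "split k1 \<noteq> None" | "split k2 \<noteq> None" by linarith
      then show False
      proof cases
        case 1
        then obtain x where "x \<in> X k1" "p x \<noteq> 0" using curve_support_interior[OF g1 c1] t by blast
        then show False using s2 gs Xs e by auto
      next
        case 2
        then obtain x where "x \<in> X k2" "p x \<noteq> 0" using curve_support_interior[OF g2 c2] t by blast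
        then show False using s1 gs Xs e by auto
      qed
    next
      case True
      then have "X k = {tgt k1}" using good_leaf g1 g2 Xs by simp
      then have ne: "src k \<noteq> tgt k" using nd by blast
      have "ept (src k1) (tgt k1) t = Inl p" using True c1 by (simp add: curve_leaf)
      then have "p (src k1) \<noteq> 0" using t by (auto simp: ept_def)
      then show False using s2 gs ne e True good_leaf[OF g2] child_ends_distinct[OF g s] by auto
    qed
  next
    case (Inr \<beta>)
    then obtain r where "r \<in> \<beta>" "eventually (\<lambda>i. r i \<in> X k1) sequentially"
      using curve_end(2)[OF g1] by blast
    moreover have "eventually (\<lambda>i. r i \<in> X k2) sequentially"
      using curve_end(3)[OF g2, of u \<beta> r] Inr eq \<open>r \<in> \<beta>\<close> by simp
    ultimately have "eventually (\<lambda>i. r i \<in> X k1 \<and> r i \<in> X k2) sequentially"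
      by (simp add: eventually_conj_iff)
    then have "eventually (\<lambda>i. False) sequentially" by (rule eventually_mono) (use Xs in blast)
    then show False by simp
  qed
qed

text \<open>As long as two parameters follow the same branch, their distance doubles at every step.\<close>

lemma curve_inj_dist:
  assumes "good k" "src k \<noteq> tgt k \<or> (\<forall>x. X k \<noteq> {x})"
    and "0 < t" "t < 1" "0 < u" "u < 1" "t < u" "1 / 2 ^ m < u - t"
  shows "curve k t \<noteq> curve k u"
  using assms
proof (induction m arbitrary: k t u)
  case (Suc m)
  note g = Suc.prems(1)
  show ?case
  proof (cases "split k")
    case None
    have "src k \<noteq> tgt k" using good_leaf[OF g None] graph_irrefl[OF graph] by metis
    then show ?thesis using ept_inj[of "src k" "tgt k" t u] Suc.prems None by (auto simp: curve_leaf)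
  next
    case (Some a)
    then obtain k1 k2 where s: "split k = Some (k1, k2)" by (cases a) auto
    have g12: "good k1" "good k2" and st: "src k2 = tgt k1" using good_split[OF g s] by auto
    have d: "1 / 2 ^ m < 2 * u - 2 * t" using Suc.prems(8) by (simp add: field_simps)
    consider "u < 1/2" | "u = 1/2" | "t < 1/2" "1/2 < u" | "t = 1/2" | "1/2 < t" by linarith
    then show ?thesis
    proof cases
      case 1
      then show ?thesis using Suc.IH[OF g12(1), of "2 * t" "2 * u"] child_ends_distinct[OF g s] Suc.prems d
        by (simp add: curve_split[OF g s])
    next
      case 2
      then have "curve k1 (2 * t) \<noteq> vpt (tgt k1)"
        using curve_interior_ne_vertex[OF g12(1)] Suc.prems by simp
      moreover have "curve k u = vpt (tgt k1)" using 2 curve_half[OF g s] by metis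
      moreover have "t \<le> 1/2" using 2 Suc.prems(7) by simp
      ultimately show ?thesis by (simp add: curve_split[OF g s, of t])
    next
      case 3
      then show ?thesis using curve_halves_disjoint[OF g s, of "2 * t" "2 * u - 1"] Suc.prems
        by (auto simp: curve_split[OF g s])
    next
      case 4
      then have "curve k2 (2 * u - 1) \<noteq> vpt (tgt k1)"
        using curve_interior_ne_vertex[OF g12(2)] Suc.prems st by simp
      moreover have "curve k t = vpt (tgt k1)" using 4 curve_half[OF g s] by metis
      moreover have "\<not> u \<le> 1/2" using 4 Suc.prems(7) by simp
      ultimately show ?thesis by (simp add: curve_split[OF g s, of u])
    next
      case 5
      then show ?thesis
        using Suc.IH[OF g12(2), of "2 * t - 1" "2 * u - 1"] child_ends_distinct[OF g s] Suc.prems d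
        by (simp add: curve_split[OF g s])
    qed
  qed
qed simp

lemma curve_inj:
  assumes "good k" "src k \<noteq> tgt k \<or> (\<forall>x. X k \<noteq> {x})"
    and "t \<in> {0<..<1}" "u \<in> {0<..<1}" "curve k t = curve k u"
  shows "t = u"
proof -
  have "\<not> a < b" if "a \<in> {0<..<1}" "b \<in> {0<..<1}" "curve k a = curve k b" for a b
  proof
    assume "a < b"
    then obtain m where "(1/2) ^ m < b - a" using real_arch_pow_inv[of "b - a" "1/2"] by auto
    then show False using curve_inj_dist[OF assms(1,2), of a b m] that \<open>a < b\<close> by (simp add: power_one_over)
  qed
  then show ?thesis using assms(3-5) by (metis linorder_neqE_linordered_idom)
qed

text \<open>A missed inner vertex \<open>x\<close> is missed by one of the halves that contains it,
  and so on forever. It would then lie in every node of an infinite branch, although some node of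
  the branch avoids the finite set \<open>{x}\<close>.\<close>

lemma curve_covers:
  assumes "good k" "x \<in> X k"
  shows "\<exists>t. 0 < t \<and> t < 1 \<and> curve k t = vpt x"
proof (rule ccontr)
  define miss where "miss k \<longleftrightarrow> good k \<and> x \<in> X k \<and> \<not> (\<exists>t. 0 < t \<and> t < 1 \<and> curve k t = vpt x)" for k
  assume "\<not> ?thesis"
  then have m0: "miss k" using assms by (simp add: miss_def)
  have stp: "\<exists>k'. miss k' \<and> (\<exists>k1 k2. split k = Some (k1, k2) \<and> k' \<in> {k1, k2})" if m: "miss k" for k
  proof -
    have g: "good k" using m by (simp add: miss_def)
    have "split k \<noteq> None"
    proof
      assume "split k = None"
      then have "X k = {}" using good_leaf[OF g] by blast
      then show False using m by (simp add: miss_def)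
    qed
    then obtain k1 k2 where s: "split k = Some (k1, k2)" by fastforce
    have "x \<noteq> tgt k1" using m curve_half[OF g s] by (force simp: miss_def)
    then have x: "x \<in> X k1 \<or> x \<in> X k2" using m X_split[OF g s] by (auto simp: miss_def)
    have "\<not> (0 < t \<and> t < 1 \<and> curve k1 t = vpt x)" for t
      using m curve_split[OF g s, of "t / 2"] by (auto simp: miss_def dest!: spec[of _ "t / 2"])
    moreover have "\<not> (0 < t \<and> t < 1 \<and> curve k2 t = vpt x)" for t
      using m curve_split[OF g s, of "(t + 1) / 2"]
      by (auto simp: miss_def field_simps dest!: spec[of _ "(t + 1) / 2"])
    ultimately show ?thesis using x s good_split[OF g s] by (auto simp: miss_def)
  qed
  obtain \<kappa> where \<kappa>: "\<kappa> 0 = k" "\<And>n. miss (\<kappa> n)"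
    "\<And>n. \<exists>k1 k2. split (\<kappa> n) = Some (k1, k2) \<and> \<kappa> (Suc n) \<in> {k1, k2}"
    using dependent_nat_choice[of "\<lambda>n k'. miss k' \<and> (n = 0 \<longrightarrow> k' = k)"
        "\<lambda>n k k'. \<exists>k1 k2. split k = Some (k1, k2) \<and> k' \<in> {k1, k2}"] m0 stp
    by (metis nat.distinct(1))
  then have "infinite_branch \<kappa>" using assms by (simp add: infinite_branch_def)
  then obtain \<rho> where "\<And>S. finite S \<Longrightarrow> \<exists>n Y. Y \<inter> S = {} \<and>
           insert (src (\<kappa> n)) (insert (tgt (\<kappa> n)) (X (\<kappa> n))) \<subseteq> Y \<and>
           (\<forall>a\<in>Y. \<forall>b\<in>Y. reach_avoid W F S a b)"
    using branch_ray by metis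
  from this[of "{x}"] show False using \<kappa>(2) by (auto simp: miss_def)
qed

section \<open>Continuity of the curve\<close>

text \<open>Continuity is taken relative to the unit interval, hence one-sided at 0 and 1; this is
  what lets two halves be glued at the midpoint.\<close>

definition near :: "'w fpoint set \<Rightarrow> 'k \<Rightarrow> real \<Rightarrow> bool" where
  "near U k t \<longleftrightarrow> (\<exists>\<delta>>0. \<forall>s\<in>{0..1}. \<bar>s - t\<bar> < \<delta> \<longrightarrow> curve k s \<in> U)"

lemma near_leaf:
  assumes U: "U \<in> freudenthal_basis W F" and k: "good k" "split k = None" and t: "t \<in> {0..1}" "curve k t \<in> U"
  shows "near U k t"
proof -
  have F: "F (src k) (tgt k)" using good_leaf k by blast
  have "openin (top_of_set {0..1}) {t \<in> {0..1}. ept (src k) (tgt k) t \<in> U}"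
  proof (cases "complex_open W F U")
    case True then show ?thesis using F by (simp add: complex_open_def)
  next
    case False
    then obtain S \<alpha> where U': "U = end_nbhd W F S \<alpha>" using U by blast
    \<comment> \<open>On the edge, the neighbourhood of the end is the union over the component of
      the sets where a coordinate does not vanish.\<close>
    let ?co = "\<lambda>x. {Inl p | p. Inl p \<in> complex_points W F \<and> p x \<in> - {0::real}}"
    have "ept (src k) (tgt k) s \<in> U \<longleftrightarrow> (\<exists>x \<in> comp_end W F S \<alpha>. ept (src k) (tgt k) s \<in> ?co x)" for s
      unfolding U' ept_def by (simp add: Inl_in_end_nbhd_iff[OF graph])
    then have "{t \<in> {0..1}. ept (src k) (tgt k) t \<in> U} =
        (\<Union>x \<in> comp_end W F S \<alpha>. {t \<in> {0..1}. ept (src k) (tgt k) t \<in> ?co x})" by blast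
    moreover have "openin (top_of_set {0..1}) {t \<in> {0..1}. ept (src k) (tgt k) t \<in> ?co x}" for x
      using complex_open_coordinate[of "- {0}" W F x] F unfolding complex_open_def by blast
    ultimately show ?thesis by (simp only: openin_Union ball_simps image_iff openin_clauses) auto
  qed
  then obtain \<delta> where "\<delta> > 0" "\<And>s. s \<in> {0..1} \<Longrightarrow> dist s t < \<delta> \<Longrightarrow> ept (src k) (tgt k) s \<in> U"
    using t k unfolding openin_euclidean_subtopology_iff by (auto simp: curve_leaf)
  then show ?thesis unfolding near_def using k by (auto simp: curve_leaf dist_real_def)
qed

lemma near_left:
  assumes g: "good k" and s: "split k = Some (k1, k2)" and t: "t < 1/2" and n: "near U k1 (2 * t)"
  shows "near U k t"
proof -
  obtain \<delta> where d: "\<delta> > 0" "\<And>s. s \<in> {0..1} \<Longrightarrow> \<bar>s - 2 * t\<bar> < \<delta> \<Longrightarrow> curve k1 s \<in> U"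
    using n unfolding near_def by blast
  \<comment> \<open>The radius is halved because the parameter doubles; the second bound keeps
    \<open>r\<close> in the left half.\<close>
  have "curve k r \<in> U" if "r \<in> {0..1}" "\<bar>r - t\<bar> < min (\<delta> / 2) (1/2 - t)" for r
  proof -
    have "\<bar>2 * r - 2 * t\<bar> < \<delta>" "r \<le> 1/2" using that(2) unfolding abs_less_iff min_less_iff_conj by linarith+
    then show ?thesis using d(2)[of "2 * r"] that(1) by (simp add: curve_split[OF g s])
  qed
  then show ?thesis unfolding near_def using d(1) t
    by (intro exI[of _ "min (\<delta> / 2) (1/2 - t)"]) auto
qed

lemma near_right:
  assumes g: "good k" and s: "split k = Some (k1, k2)" and t: "1/2 < t" and n: "near U k2 (2 * t - 1)"
  shows "near U k t"
proof -
  obtain \<delta> where d: "\<delta> > 0" "\<And>s. s \<in> {0..1} \<Longrightarrow> \<bar>s - (2 * t - 1)\<bar> < \<delta> \<Longrightarrow> curve k2 s \<in> U"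
    using n unfolding near_def by blast
  have "curve k r \<in> U" if "r \<in> {0..1}" "\<bar>r - t\<bar> < min (\<delta> / 2) (t - 1/2)" for r
  proof -
    have "\<bar>(2 * r - 1) - (2 * t - 1)\<bar> < \<delta>" "\<not> r \<le> 1/2" using that(2) unfolding abs_less_iff min_less_iff_conj by linarith+
    then show ?thesis using d(2)[of "2 * r - 1"] that(1) by (simp add: curve_split[OF g s])
  qed
  then show ?thesis unfolding near_def using d(1) t
    by (intro exI[of _ "min (\<delta> / 2) (t - 1/2)"]) auto
qed

text \<open>The leftmost descent reaches an edge after finitely many halvings, so continuity at the
  start of a stretch reduces to continuity on a single edge.\<close>

lemma near_0:
  assumes U: "U \<in> freudenthal_basis W F" and g: "good k" and "vpt (src k) \<in> U"
  shows "near U k 0"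
  using left_terminates[OF g] g assms(3)
proof (induction rule: terminates.induct)
  case (terminatesI k)
  show ?case
  proof (cases "split k")
    case None then show ?thesis using near_leaf[OF U] terminatesI.prems curve_0 by simp
  next
    case (Some a)
    then obtain k1 k2 where s: "split k = Some (k1, k2)" by (cases a) auto
    show ?thesis using terminatesI.IH[of k1] s good_split[OF terminatesI.prems(1) s] terminatesI.prems
      by (intro near_left[OF terminatesI.prems(1) s]) auto
  qed
qed

lemma near_1:
  assumes U: "U \<in> freudenthal_basis W F" and g: "good k" and "vpt (tgt k) \<in> U"
  shows "near U k 1"
  using right_terminates[OF g] g assms(3)
proof (induction rule: terminates.induct)
  case (terminatesI k)
  show ?case
  proof (cases "split k")
    case None then show ?thesis using near_leaf[OF U] terminatesI.prems curve_1 by simp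
  next
    case (Some a)
    then obtain k1 k2 where s: "split k = Some (k1, k2)" by (cases a) auto
    show ?thesis using terminatesI.IH[of k2] s good_split[OF terminatesI.prems(1) s] terminatesI.prems
      by (intro near_right[OF terminatesI.prems(1) s]) auto
  qed
qed

lemma near_half:
  assumes U: "U \<in> freudenthal_basis W F" and g: "good k" and s: "split k = Some (k1, k2)"
    and m: "vpt (tgt k1) \<in> U"
  shows "near U k (1/2)"
proof -
  have "near U k1 1" "near U k2 0"
    using near_1[OF U, of k1] near_0[OF U, of k2] m good_split[OF g s] by auto
  then obtain \<delta> \<epsilon> where d: "\<delta> > 0" "\<And>s. s \<in> {0..1} \<Longrightarrow> \<bar>s - 1\<bar> < \<delta> \<Longrightarrow> curve k1 s \<in> U"
    and e: "\<epsilon> > 0" "\<And>s. s \<in> {0..1} \<Longrightarrow> \<bar>s - 0\<bar> < \<epsilon> \<Longrightarrow> curve k2 s \<in> U"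
    unfolding near_def by metis
  have "curve k r \<in> U" if "r \<in> {0..1}" "\<bar>r - 1/2\<bar> < min (\<delta> / 2) (\<epsilon> / 2)" for r
  proof (cases "r \<le> 1/2")
    case True
    then have "\<bar>2 * r - 1\<bar> < \<delta>" using that(2) unfolding abs_less_iff min_less_iff_conj by linarith+
    then show ?thesis using d(2)[of "2 * r"] that(1) True by (simp add: curve_split[OF g s])
  next
    case False
    then have "\<bar>2 * r - 1\<bar> < \<epsilon>" using that(2) unfolding abs_less_iff min_less_iff_conj by linarith+
    then show ?thesis using e(2)[of "2 * r - 1"] that(1) False by (simp add: curve_split[OF g s])
  qed
  then show ?thesis unfolding near_def using d(1) e(1)
    by (intro exI[of _ "min (\<delta> / 2) (\<epsilon> / 2)"]) auto
qed

lemma near_stops: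
  assumes U: "U \<in> freudenthal_basis W F" and "stops k t" "good k" "t \<in> {0..1}" "curve k t \<in> U"
  shows "near U k t"
  using assms(2-5)
proof (induction rule: stops_induct)
  case (leaf k t) then show ?case using near_leaf[OF U] by blast
next
  case (split k k1 k2 t)
  consider "t < 1/2" | "t = 1/2" | "t > 1/2" by linarith
  then show ?case
  proof cases
    case 1
    then show ?thesis using split by (intro near_left[OF split(1,2)]) (auto simp: curve_split)
  next
    case 2
    have "vpt (tgt k1) \<in> U" using split.prems(2) 2 curve_half[OF split(1,2)] by metis
    then show ?thesis unfolding 2 by (rule near_half[OF U split(1,2)])
  next
    case 3
    then show ?thesis using split by (intro near_right[OF split(1,2)]) (auto simp: curve_split)
  qed
qed

text \<open>A walk that never stops cannot hit the midpoint, where the curve passes a vertex. At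
  each step the parameter is therefore strictly inside one half, and control over the node at depth
  \<open>n\<close> gives control in a neighbourhood of \<open>t\<close>.\<close>

lemma near_walk:
  assumes "\<not> stops k t" "good k" "t \<in> {0..1}" "\<And>s. s \<in> {0..1} \<Longrightarrow> curve (fst (walk k t n)) s \<in> U"
  shows "near U k t"
  using assms
proof (induction n arbitrary: k t)
  case 0
  then show ?case unfolding near_def by (auto intro: exI[of _ 1])
next
  case (Suc n)
  obtain k1 k2 where s: "split k = Some (k1, k2)"
    using Suc.prems(1) stops_leaf by (metis not_None_eq surj_pair)
  note g = good_split[OF Suc.prems(2) s]
  have "t \<noteq> 1/2"
    using curve_half[OF Suc.prems(2) s] curve_nonstop[OF Suc.prems(1)] by (metis vpt_ne_Inr(1))
  then consider "t < 1/2" | "t > 1/2" by linarith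
  then show ?case
  proof cases
    case 1
    then have "near U k1 (2 * t)"
      using Suc.prems g stops_split[OF s] s by (intro Suc.IH) (auto simp: walk_Suc step_def)
    then show ?thesis using near_left[OF Suc.prems(2) s] 1 by blast
  next
    case 2
    then have "near U k2 (2 * t - 1)"
      using Suc.prems g stops_split[OF s] s by (intro Suc.IH) (auto simp: walk_Suc step_def)
    then show ?thesis using near_right[OF Suc.prems(2) s] 2 by blast
  qed
qed

text \<open>Some node of the branch lies, endpoints included, in a connected set \<open>Y\<close>
  that avoids \<open>S\<close>. A ray of the end has a tail both in that node and in the component,
  so \<open>Y\<close> is contained in the component and the whole stretch of the node is mapped into
  \<open>U\<close>.\<close>

lemma near_nonstop:
  assumes U: "U \<in> freudenthal_basis W F" and ns: "\<not> stops k t" and g: "good k"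
    and t: "t \<in> {0..1}" "curve k t \<in> U"
  shows "near U k t"
proof -
  let ?\<kappa> = "\<lambda>n. fst (walk k t n)"
  have c: "curve k t = Inr (END ?\<kappa>)" by (rule curve_nonstop[OF ns])
  have br: "infinite_branch ?\<kappa>" by (rule walk_branch[OF ns g])
  have "Inr (END ?\<kappa>) \<notin> complex_points W F" by (auto simp: complex_points_def)
  then have "\<not> complex_open W F U" using t c unfolding complex_open_def by auto
  then obtain S \<alpha> where U': "U = end_nbhd W F S \<alpha>" "finite S" using U by blast
  let ?C = "comp_end W F S \<alpha>"
  obtain r N where r: "r \<in> END ?\<kappa>" "\<forall>i\<ge>N. r i \<in> ?C"
    using t(2) c U' Inr_in_end_nbhd_iff by metis
  obtain n Y where Y: "Y \<inter> S = {}" "insert (src (?\<kappa> n)) (insert (tgt (?\<kappa> n)) (X (?\<kappa> n))) \<subseteq> Y"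
    "\<forall>a\<in>Y. \<forall>b\<in>Y. reach_avoid W F S a b"
    using branch_ray[OF br] U'(2) by metis
  have "eventually (\<lambda>i. r i \<in> X (?\<kappa> n)) sequentially" using r(1) by (simp add: END_def)
  then obtain M where "\<forall>i\<ge>M. r i \<in> X (?\<kappa> n)" unfolding eventually_sequentially by blast
  then have "r (max N M) \<in> Y" "r (max N M) \<in> ?C" using Y(2) r(2) by auto
  then have YC: "Y \<subseteq> ?C" using Y(3) comp_end_reach[OF graph] by blast
  have gn: "good (?\<kappa> n)" by (rule good_walk[OF g])
  have "curve (?\<kappa> n) s \<in> U" if s: "s \<in> {0..1}" for s
  proof (cases "curve (?\<kappa> n) s")
    case (Inl p)
    then have p: "Inl p \<in> complex_points W F" "{x. p x \<noteq> 0} \<subseteq> Y"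
      using curve_support[OF gn Inl] s Y(2) by auto
    have "\<exists>x. p x \<noteq> 0"
      using p(1)
    proof (cases rule: complex_pointsE)
      case (vertex v) then show ?thesis by (auto simp: vpt_def)
    next
      case (edge u v t) 
      then have "p u = 1 - t" "u \<noteq> v \<Longrightarrow> p v = t" "u \<noteq> v"
        using graph_irrefl[OF graph] by (auto simp: ept_def)
      then show ?thesis by (metis diff_zero zero_neq_one)
    qed
    then show ?thesis using p YC Inl U' by (auto simp: Inl_in_end_nbhd_iff[OF graph])
  next
    case (Inr \<beta>)
    obtain q where q: "q \<in> \<beta>" "eventually (\<lambda>i. q i \<in> X (?\<kappa> n)) sequentially"
      using curve_end(2)[OF gn Inr] by blast
    then obtain M where "\<forall>i\<ge>M. q i \<in> X (?\<kappa> n)" unfolding eventually_sequentially by blast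
    then have "\<forall>i\<ge>M. q i \<in> ?C" using Y(2) YC by blast
    then show ?thesis using Inr U' q(1) curve_end(1)[OF gn Inr] Inr_in_end_nbhd_iff by metis
  qed
  then show ?thesis by (rule near_walk[OF ns g t(1)])
qed

lemma continuous_curve:
  assumes g: "good k"
  shows "continuous_map (top_of_set {0..1}) (freudenthal W F) (curve k)"
proof (rule continuous_map_freudenthal[OF graph])
  fix U assume U: "U \<in> freudenthal_basis W F"
  have "\<exists>\<delta>>0. \<forall>s\<in>{0..1}. dist s t < \<delta> \<longrightarrow> curve k s \<in> U" if "t \<in> {0..1}" "curve k t \<in> U" for t
    using near_stops[OF U _ g that] near_nonstop[OF U _ g that] unfolding near_def dist_real_def by blast
  then show "openin (top_of_set {0..1}) {x \<in> topspace (top_of_set {0..1}). curve k x \<in> U}"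
    unfolding openin_euclidean_subtopology_iff by (simp add: subset_iff)
next
  fix t :: real assume t: "t \<in> topspace (top_of_set {0..1})"
  show "curve k t \<in> complex_points W F \<union> Inr ` ends W F"
    using curve_support[OF g, of t] curve_end(1)[OF g, of t] t by (cases "curve k t") auto
qed

section \<open>From a closed curve to a circle\<close>

text \<open>The values at 0 and 1 agree on a closed stretch, so the curve factors through the
  quotient map from the interval to the circle; this gives continuity of \<open>f\<close> in spite
  of the jump of \<open>Arg2pi\<close>. A single inner vertex is excluded because the curve would
  run one edge forth and back.\<close>

theorem hamiltonian_circle_curve:
  assumes g: "good k" and loop: "src k = tgt k" and nt: "\<And>x. X k \<noteq> {x}" and all: "insert (src k) (X k) = W"
  shows "\<exists>C. hamiltonian_circle W F C"
proof -
  let ?I = "top_of_set {0..1::real}" and ?S = "top_of_set (sphere (0::complex) 1)"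
  let ?e = "\<lambda>t::real. cis (2 * pi * t)"
  define f where "f z = curve k (Arg2pi z / (2 * pi))" for z
  have fe: "f (?e t) = curve k t" if t: "t \<in> {0..1}" for t
  proof (cases "t = 1")
    case True
    then show ?thesis using curve_0[OF g] curve_1[OF g] loop Arg2pi_of_real[of 1] by (simp add: f_def)
  next
    case False
    have "Arg2pi (?e t) = 2 * pi * t"
      using t False by (intro Arg2pi_unique[of 1]) (auto simp: cis_conv_exp mult.commute)
    then show ?thesis by (simp add: f_def)
  qed
  have quot: "quotient_map ?I ?S ?e"
  proof (rule continuous_imp_quotient_map)
    show "continuous_map ?I ?S ?e"
      by (auto intro!: continuous_intros simp: norm_cis)
    show "?e ` topspace ?I = topspace ?S"
    proof (intro equalityI subsetI)
      fix z :: complex assume "z \<in> topspace ?S"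
      then have z: "norm z = 1" by simp
      have "z = ?e (Arg2pi z / (2 * pi))"
        using Arg2pi_eq[of z] z by (simp add: cis_conv_exp mult.commute)
      moreover have "Arg2pi z / (2 * pi) \<in> {0..1}"
        using Arg2pi_ge_0[of z] Arg2pi_lt_2pi[of z] by (auto simp: field_simps)
      ultimately show "z \<in> ?e ` topspace ?I"
        unfolding topspace_euclidean_subtopology by (rule image_eqI)
    qed auto
    show "compact_space ?I" by (simp add: compact_space_subtopology compactin_euclidean_iff)
    show "Hausdorff_space ?S" by (simp add: Hausdorff_space_subtopology)
  qed
  have "continuous_map ?I (freudenthal W F) (f \<circ> ?e)"
    using continuous_curve[OF g] by (rule continuous_map_eq) (use fe in auto)
  then have cont: "continuous_map ?S (freudenthal W F) f"
    using continuous_compose_quotient_map[OF quot] by blast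
  have "closed_map ?S (freudenthal W F) f"
    by (rule continuous_imp_closed_map[OF cont _ Hausdorff_freudenthal[OF graph locally_finite]])
      (simp add: compact_space_subtopology compactin_euclidean_iff)
  moreover have "inj_on f (topspace ?S)"
  proof (rule inj_onI)
    fix y z assume yz: "y \<in> topspace ?S" "z \<in> topspace ?S" "f y = f z"
    have eqz: "z = ?e (Arg2pi z / (2 * pi))" and A: "Arg2pi z / (2 * pi) \<in> {0..<1}"
      if "z \<in> topspace ?S" for z
      using that Arg2pi_eq[of z] Arg2pi_ge_0[of z] Arg2pi_lt_2pi[of z]
      by (auto simp: cis_conv_exp mult.commute field_simps)
    let ?a = "Arg2pi y / (2 * pi)" and ?b = "Arg2pi z / (2 * pi)"
    have c: "curve k ?a = curve k ?b" using yz(3) by (simp add: f_def)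
    have "?a = ?b"
    proof (cases "?a = 0 \<or> ?b = 0")
      case True
      have "curve k 0 = vpt (src k)" by (rule curve_0[OF g])
      then show ?thesis using True c A[OF yz(1)] A[OF yz(2)] curve_interior_ne_vertex[OF g]
        by (metis atLeastLessThan_iff insertI1 order_le_imp_less_or_eq)
    next
      case False
      then have "?a \<in> {0<..<1}" "?b \<in> {0<..<1}"
        using A[OF yz(1)] A[OF yz(2)] by (metis atLeastLessThan_iff greaterThanLessThan_iff order_less_le)+
      then show ?thesis using c nt by (intro curve_inj[OF g]) auto
    qed
    then show "y = z" using eqz[OF yz(1)] eqz[OF yz(2)] by simp
  qed
  ultimately have "embedding_map ?S (freudenthal W F) f"
    using injective_closed_imp_embedding_map[OF cont] by blast
  moreover have "vpt ` W \<subseteq> f ` sphere 0 1"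
  proof
    fix p assume "p \<in> vpt ` W"
    then obtain x where x: "x \<in> W" "p = vpt x" by blast
    have "\<exists>t \<in> {0..1}. curve k t = vpt x"
    proof (cases "x = src k")
      case True then show ?thesis using curve_0[OF g] by (intro bexI[of _ 0]) auto
    next
      case False
      then have "x \<in> X k" using all x by blast
      then show ?thesis using curve_covers[OF g] by fastforce
    qed
    then obtain t where "t \<in> {0..1}" "curve k t = p" using x by blast
    then have "f (?e t) = p" using fe by simp
    then show "p \<in> f ` sphere 0 1" by (intro image_eqI[of _ _ "?e t"]) auto
  qed
  ultimately show ?thesis unfolding hamiltonian_circle_def by blast
qed

end

subsection \<open>Depth-first search trees\<close>

locale infinite_graph =
  fixes V :: "'a set" and E :: "'a \<Rightarrow> 'a \<Rightarrow> bool"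
  assumes graph: "graph V E" and infinite_V: "infinite V"
    and locally_finite: "locally_finite V E" and connected: "connected_graph V E"
begin

lemma E_sym: "E x y \<Longrightarrow> E y x" and E_irrefl: "\<not> E x x" and E_V: "E x y \<Longrightarrow> x \<in> V \<and> y \<in> V"
  using graph by (auto simp: graph_def)

lemma finite_nbrs: "finite {y. E x y}"
proof (cases "x \<in> V")
  case True
  then show ?thesis using locally_finite by (simp add: locally_finite_def)
next
  case False
  then have "{y. E x y} = {}" using E_V by blast
  then show ?thesis by simp
qed

definition adj :: "'a set \<Rightarrow> 'a \<Rightarrow> 'a \<Rightarrow> bool" where
  "adj A x y \<longleftrightarrow> E x y \<and> x \<in> A \<and> y \<in> A"

definition conn :: "'a set \<Rightarrow> bool" where
  "conn A \<longleftrightarrow> (\<forall>x\<in>A. \<forall>y\<in>A. (adj A)\<^sup>*\<^sup>* x y)"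

definition component :: "'a set \<Rightarrow> 'a \<Rightarrow> 'a set" where
  "component A c = {x. (adj A)\<^sup>*\<^sup>* c x}"

definition distance :: "'a set \<Rightarrow> 'a \<Rightarrow> 'a \<Rightarrow> nat" where
  "distance A x y = (LEAST n. (adj A ^^ n) x y)"

definition target :: "'a set \<Rightarrow> 'a" where
  "target K = arg_min (to_nat_on V) (\<lambda>x. x \<in> K)"

text \<open>Here \<open>K\<close> is a component below the parent \<open>v\<close>. Among the
  neighbours of \<open>v\<close> in it, the root is one nearest to \<open>target K\<close>, which is
  what \<open>descent\<close> needs.\<close>

definition pick :: "'a set \<Rightarrow> 'a \<Rightarrow> 'a" where
  "pick K v = arg_min (\<lambda>c. distance K c (target K)) (\<lambda>c. c \<in> K \<and> E v c)"

definition kid_sets :: "'a set \<Rightarrow> 'a \<Rightarrow> 'a set set" where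
  "kid_sets K v = component (K - {v}) ` {c \<in> K. E v c}"

definition node :: "'a set \<Rightarrow> 'a \<Rightarrow> bool" where
  "node K v \<longleftrightarrow> v \<in> K \<and> K \<subseteq> V \<and> conn K \<and> finite {(x, y). E x y \<and> x \<in> K \<and> y \<notin> K}"

text \<open>\<open>(K, v)\<close> stands for the subtree \<open>K\<close> with root \<open>v\<close> of a depth-first search tree; the subtrees below
  it are the components of \<open>K - v\<close>.\<close>

definition kids :: "'a set \<Rightarrow> 'a \<Rightarrow> ('a set \<times> 'a) list" where
  "kids K v = (SOME xs. distinct xs \<and> set xs = (\<lambda>K'. (K', pick K' v)) ` kid_sets K v \<and>
     ((\<exists>p \<in> set xs. fst p = {snd p}) \<longrightarrow> fst (last xs) = {snd (last xs)}))"

section \<open>Components and shortest paths\<close>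

lemma adj_sym: "(adj A)\<^sup>*\<^sup>* x y \<Longrightarrow> (adj A)\<^sup>*\<^sup>* y x"
proof -
  have "symp (adj A)" using E_sym by (auto simp: adj_def intro: sympI)
  then show "(adj A)\<^sup>*\<^sup>* x y \<Longrightarrow> (adj A)\<^sup>*\<^sup>* y x" by (meson sympD symp_rtranclp)
qed

lemma component_sub: "c \<in> A \<Longrightarrow> component A c \<subseteq> A"
proof
  fix x assume "c \<in> A" "x \<in> component A c"
  then have "(adj A)\<^sup>*\<^sup>* c x" by (simp add: component_def)
  then show "x \<in> A" by (induction rule: rtranclp_induct) (use \<open>c \<in> A\<close> in \<open>auto simp: adj_def\<close>)
qed

lemma component_self: "c \<in> component A c"
  by (simp add: component_def)

lemma component_closed: "x \<in> component A c \<Longrightarrow> adj A x y \<Longrightarrow> y \<in> component A c"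
  unfolding component_def by (simp add: rtranclp.rtrancl_into_rtrancl)

lemma component_eq: "x \<in> component A c \<Longrightarrow> component A x = component A c"
  unfolding component_def using adj_sym rtranclp_trans[of "adj A"] by blast

lemma relpowp_component: "(adj A ^^ n) c x \<Longrightarrow> (adj (component A c) ^^ n) c x"
proof (induction n arbitrary: x)
  case (Suc n)
  then obtain y where y: "(adj A ^^ n) c y" "adj A y x" by auto
  then have "y \<in> component A c" unfolding component_def by (simp add: relpowp_imp_rtranclp)
  moreover have "x \<in> component A c" using component_closed[OF calculation y(2)] .
  ultimately have "adj (component A c) y x" using y(2) by (simp add: adj_def)
  then show ?case using Suc.IH[OF y(1)] by auto
qed simp

lemma conn_component: "conn (component A c)"
proof -
  have "(adj (component A c))\<^sup>*\<^sup>* c x" if "x \<in> component A c" for x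
  proof -
    have "(adj A)\<^sup>*\<^sup>* c x" using that by (simp add: component_def)
    then obtain n where "(adj A ^^ n) c x" using rtranclp_imp_relpowp by metis
    then show ?thesis using relpowp_component relpowp_imp_rtranclp by metis
  qed
  then show ?thesis unfolding conn_def using adj_sym rtranclp_trans by metis
qed

text \<open>If the path met \<open>v\<close>, its remainder would lead from \<open>v\<close> to
  \<open>x\<close> in at most \<open>n\<close> steps.\<close>

lemma relpowp_avoid:
  "(adj K ^^ n) c x \<Longrightarrow> (\<And>m. m \<le> n \<Longrightarrow> \<not> (adj K ^^ m) v x) \<Longrightarrow> (adj (K - {v}) ^^ n) c x"
proof (induction n arbitrary: c)
  case (Suc n)
  obtain y where y: "adj K c y" "(adj K ^^ n) y x" using relpowp_Suc_D2[OF Suc.prems(1)] by blast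
  have "c \<noteq> v" using Suc.prems by blast
  moreover have "y \<noteq> v" using Suc.prems(2)[of n] y(2) by auto
  ultimately have "adj (K - {v}) c y" using y(1) by (simp add: adj_def)
  moreover have "(adj (K - {v}) ^^ n) y x" using Suc.IH[OF y(2)] Suc.prems(2) by simp
  ultimately show ?case by (rule relpowp_Suc_I2)
qed simp

lemma distance_le: "(adj A ^^ n) x y \<Longrightarrow> distance A x y \<le> n"
  unfolding distance_def by (rule Least_le)

text \<open>A shortest path from \<open>v\<close> does not return to \<open>v\<close>.\<close>

lemma first_step:
  assumes "conn K" "v \<in> K" "x \<in> K" "x \<noteq> v"
  obtains c m where "E v c" "c \<in> K" "distance K v x = Suc m" "(adj (K - {v}) ^^ m) c x"
proof -
  obtain n where n: "(adj K ^^ n) v x" "n = distance K v x"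
    unfolding distance_def using assms LeastI_ex[of "\<lambda>n. (adj K ^^ n) v x"]
    by (metis conn_def rtranclp_imp_relpowp)
  have "n \<noteq> 0" using n(1) assms(4) by (metis relpowp_0_E)
  then obtain m where m: "n = Suc m" using not0_implies_Suc by blast
  then obtain c where c: "adj K v c" "(adj K ^^ m) c x" using relpowp_Suc_D2[of m "adj K"] n(1) by blast
  have "\<not> (adj K ^^ m') v x" if "m' \<le> m" for m'
    using distance_le[of m' K v x] that n m by auto
  then have "(adj (K - {v}) ^^ m) c x" using relpowp_avoid[OF c(2)] by blast
  moreover have "distance K v x = Suc m" using n(2) m by simp
  ultimately show thesis using that c(1) unfolding adj_def by blast
qed

section \<open>The components below a root\<close>

lemma kid_sets_sub:
  assumes "K' \<in> kid_sets K v" shows "K' \<subseteq> K - {v}"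
proof -
  obtain c where "c \<in> K" "E v c" "K' = component (K - {v}) c"
    using assms unfolding kid_sets_def by blast
  then show ?thesis using component_sub[of c "K - {v}"] E_irrefl by blast
qed

lemma kid_sets_nbr: "K' \<in> kid_sets K v \<Longrightarrow> \<exists>c \<in> K'. E v c"
  unfolding kid_sets_def using component_self by blast

lemma kid_sets_disjoint:
  "K1 \<in> kid_sets K v \<Longrightarrow> K2 \<in> kid_sets K v \<Longrightarrow> K1 \<noteq> K2 \<Longrightarrow> K1 \<inter> K2 = {}"
  unfolding kid_sets_def using component_eq by blast

lemma Union_kid_sets:
  assumes "conn K" "v \<in> K" shows "\<Union> (kid_sets K v) = K - {v}"
proof
  show "\<Union> (kid_sets K v) \<subseteq> K - {v}" using kid_sets_sub by blast
  show "K - {v} \<subseteq> \<Union> (kid_sets K v)"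
  proof
    fix x assume "x \<in> K - {v}"
    then obtain c m where "E v c" "c \<in> K" "(adj (K - {v}) ^^ m) c x"
      using first_step[OF assms, of x] by blast
    then have "c \<in> K \<and> E v c" "x \<in> component (K - {v}) c"
      unfolding component_def by (auto dest: relpowp_imp_rtranclp)
    then show "x \<in> \<Union> (kid_sets K v)" unfolding kid_sets_def by blast
  qed
qed

lemma finite_kid_sets: "finite (kid_sets K v)"
  unfolding kid_sets_def using finite_nbrs[of v] by simp

text \<open>This is where the depth-first structure is used: an edge leaving a component of
  \<open>K - {v}\<close> either leaves \<open>K\<close> or ends in \<open>v\<close>, and
  \<open>v\<close> has finite degree. Hence finite boundaries are inherited, whichever vertex
  \<open>c\<close> is the root.\<close>

lemma kid_sets_node:
  assumes n: "node K v" and K': "K' \<in> kid_sets K v" and c: "c \<in> K'"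
  shows "node K' c"
proof -
  obtain d where d: "d \<in> K" "E v d" "K' = component (K - {v}) d"
    using K' unfolding kid_sets_def by blast
  have sub: "K' \<subseteq> K - {v}" by (rule kid_sets_sub[OF K'])
  have "{(x, y). E x y \<and> x \<in> K' \<and> y \<notin> K'} \<subseteq>
      {(x, y). E x y \<and> x \<in> K \<and> y \<notin> K} \<union> (\<lambda>x. (x, v)) ` {x. E v x}"
  proof
    fix p assume "p \<in> {(x, y). E x y \<and> x \<in> K' \<and> y \<notin> K'}"
    then obtain x y where p: "p = (x, y)" "E x y" "x \<in> K'" "y \<notin> K'" by blast
    then have "\<not> adj (K - {v}) x y" using component_closed d by blast
    then have "y \<notin> K \<or> y = v" using p sub by (auto simp: adj_def)
    then show "p \<in> {(x, y). E x y \<and> x \<in> K \<and> y \<notin> K} \<union> (\<lambda>x. (x, v)) ` {x. E v x}"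
      using p sub E_sym by blast
  qed
  moreover have "finite ({(x, y). E x y \<and> x \<in> K \<and> y \<notin> K} \<union> (\<lambda>x. (x, v)) ` {x. E v x})"
    using n finite_nbrs by (simp add: node_def)
  ultimately have "finite {(x, y). E x y \<and> x \<in> K' \<and> y \<notin> K'}" by (rule finite_subset)
  then show ?thesis using n c sub conn_component d unfolding node_def by blast
qed

lemma pick:
  assumes "K' \<in> kid_sets K v"
  shows "pick K' v \<in> K'" "E v (pick K' v)"
    "\<And>c. c \<in> K' \<Longrightarrow> E v c \<Longrightarrow> distance K' (pick K' v) (target K') \<le> distance K' c (target K')"
proof -
  obtain c where "c \<in> K' \<and> E v c" using kid_sets_nbr[OF assms] by blast
  from arg_min_nat_lemma[of "\<lambda>c. c \<in> K' \<and> E v c", OF this, of "\<lambda>c. distance K' c (target K')"]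
  show "pick K' v \<in> K'" "E v (pick K' v)"
    "\<And>c. c \<in> K' \<Longrightarrow> E v c \<Longrightarrow> distance K' (pick K' v) (target K') \<le> distance K' c (target K')"
    unfolding pick_def by auto
qed

lemma target:
  assumes "x \<in> K"
  shows "target K \<in> K" "to_nat_on V (target K) \<le> to_nat_on V x"
  using arg_min_nat_lemma[of "\<lambda>x. x \<in> K", OF assms, of "to_nat_on V"] assms
  unfolding target_def by auto

text \<open>A kid that is a single vertex, if there is one, comes last. So if the last kid has more
  than one vertex, then all kids do, and in \<open>mid\<close> the first one can be entered at the
  root of one of its own kids.\<close>

lemma kids:
  "distinct (kids K v)" "set (kids K v) = (\<lambda>K'. (K', pick K' v)) ` kid_sets K v"
  "p \<in> set (kids K v) \<Longrightarrow> fst p = {snd p} \<Longrightarrow> fst (last (kids K v)) = {snd (last (kids K v))}"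
proof -
  let ?A = "(\<lambda>K'. (K', pick K' v)) ` kid_sets K v"
  let ?P = "\<lambda>xs. distinct xs \<and> set xs = ?A \<and>
     ((\<exists>p \<in> set xs. fst p = {snd p}) \<longrightarrow> fst (last xs) = {snd (last xs)})"
  have "\<exists>xs. ?P xs"
  proof (cases "\<exists>p \<in> ?A. fst p = {snd p}")
    case True
    then obtain p where p: "p \<in> ?A" "fst p = {snd p}" by blast
    obtain xs where "set xs = ?A - {p}" "distinct xs"
      using finite_distinct_list[of "?A - {p}"] finite_kid_sets by blast
    then have "?P (xs @ [p])" using p by auto
    then show ?thesis by blast
  next
    case False
    obtain xs where "set xs = ?A" "distinct xs"
      using finite_distinct_list[of ?A] finite_kid_sets by blast
    then have "?P xs" using False by auto
    then show ?thesis by blast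
  qed
  then have "?P (kids K v)" unfolding kids_def by (rule someI_ex)
  then show "distinct (kids K v)" "set (kids K v) = ?A"
    "p \<in> set (kids K v) \<Longrightarrow> fst p = {snd p} \<Longrightarrow> fst (last (kids K v)) = {snd (last (kids K v))}"
    by blast+
qed

section \<open>Every branch leaves every vertex behind\<close>

lemma countable_V: "countable V"
proof -
  have "V \<noteq> {}" using infinite_V by auto
  then obtain o' where o': "o' \<in> V" by blast
  define B where "B n = {x. ((\<lambda>x y. E x y) ^^ n) o' x}" for n
  have "finite (B n)" for n
  proof (induction n)
    case (Suc n)
    have "B (Suc n) \<subseteq> (\<Union>x \<in> B n. {y. E x y})" by (auto simp: B_def)
    then show ?case using Suc finite_nbrs by (meson finite_UN_I finite_subset)
  qed (simp add: B_def)
  then have "countable (\<Union>n. B n)" by (simp add: countable_finite)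
  moreover have "V \<subseteq> (\<Union>n. B n)"
  proof
    fix x assume "x \<in> V"
    then have "(\<lambda>a b. E a b \<and> a \<in> V \<and> b \<in> V)\<^sup>*\<^sup>* o' x"
      using connected o' by (simp add: connected_graph_def)
    then have "E\<^sup>*\<^sup>* o' x" by (rule rtranclp_mono[THEN predicate2D, rotated]) auto
    then show "x \<in> (\<Union>n. B n)" unfolding B_def using rtranclp_imp_relpowp by fastforce
  qed
  ultimately show ?thesis by (rule countable_subset[rotated])
qed

text \<open>The roots are picked so as to approach the vertex of least index: as long as that vertex
  stays the same along a branch of the depth-first search tree, its distance to the root drops.\<close>

lemma descent:
  assumes n: "node K v" and K': "K' \<in> kid_sets K v"
  shows "to_nat_on V (target K) < to_nat_on V (target K') \<or>
    target K' = target K \<and> distance K' (pick K' v) (target K') < distance K v (target K)"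
proof -
  have v: "v \<in> K" "conn K" "K \<subseteq> V" using n by (auto simp: node_def)
  have sub: "K' \<subseteq> K - {v}" by (rule kid_sets_sub[OF K'])
  have tK': "target K' \<in> K'" using target(1) kid_sets_nbr[OF K'] by blast
  have le: "to_nat_on V (target K) \<le> to_nat_on V (target K')" using target(2)[of "target K'" K] tK' sub by blast
  show ?thesis
  proof (cases "to_nat_on V (target K) = to_nat_on V (target K')")
    case True
    then have eq: "target K' = target K"
      using inj_onD[OF inj_on_to_nat_on[OF countable_V], of "target K'" "target K"]
        tK' sub v(3) target(1)[OF v(1)] by fastforce
    let ?x = "target K"
    have "?x \<in> K" "?x \<noteq> v" using tK' sub unfolding eq by blast+
    then obtain c m where c: "E v c" "c \<in> K" "distance K v ?x = Suc m" "(adj (K - {v}) ^^ m) c ?x"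
      by (rule first_step[OF v(2,1)])
    \<comment> \<open>The component of \<open>c\<close> and the set \<open>K'\<close> share the
      target, so they coincide. Thus \<open>c\<close> competes with \<open>pick K' v\<close>, at
      distance at most \<open>m\<close> from the target, one less than the distance from
      \<open>v\<close>.\<close>
    have x: "?x \<in> component (K - {v}) c"
      using c(4) unfolding component_def by (simp add: relpowp_imp_rtranclp)
    have "component (K - {v}) c \<in> kid_sets K v" using c unfolding kid_sets_def by blast
    then have K'c: "K' = component (K - {v}) c"
      using kid_sets_disjoint[OF K'] x tK' unfolding eq by blast
    have "(adj K' ^^ m) c ?x" using relpowp_component[OF c(4)] K'c by simp
    then have "distance K' c ?x \<le> m" by (rule distance_le)
    moreover have "c \<in> K'" using K'c component_self by blast
    ultimately show ?thesis using pick(3)[OF K' _ c(1)] c(3) eq by fastforce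
  qed (use le in simp)
qed

lemma branch_escapes:
  assumes "\<And>j. node (K j) (v j)" "\<And>j. (K (Suc j), v (Suc j)) \<in> set (kids (K j) (v j))"
  shows "\<exists>j. x \<notin> K j"
proof (rule ccontr)
  assume c: "\<not> ?thesis"
  have k: "K (Suc j) \<in> kid_sets (K j) (v j)" "v (Suc j) = pick (K (Suc j)) (v j)" for j
    using assms(2)[of j] by (auto simp: kids(2))
  let ?i = "\<lambda>j. to_nat_on V (target (K j))"
  \<comment> \<open>As long as \<open>x\<close> stays in every \<open>K j\<close>, its index bounds
    that of the target, so the subtraction is not truncated. By \<open>descent\<close> either the
    target index grows or the root moves closer, and the pair decreases lexicographically.\<close>
  let ?g = "\<lambda>j. (to_nat_on V x - ?i j, distance (K j) (v j) (target (K j)))"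
  have "(?g (Suc j), ?g j) \<in> less_than <*lex*> less_than" for j
  proof -
    have "?i (Suc j) \<le> to_nat_on V x" using target(2) c by blast
    moreover have "?i j < ?i (Suc j) \<or> target (K (Suc j)) = target (K j) \<and>
        distance (K (Suc j)) (v (Suc j)) (target (K (Suc j))) < distance (K j) (v j) (target (K j))"
      using descent[OF assms(1)[of j] k(1)[of j]] unfolding k(2)[of j] .
    ultimately show ?thesis unfolding in_lex_prod less_than_iff by (elim disjE conjE) (simp add: diff_less_mono2, simp)
  qed
  moreover have "wf (less_than <*lex*> less_than)" by (simp add: wf_lex_prod)
  then obtain j where "(?g (Suc j), ?g j) \<notin> less_than <*lex*> less_than"
    by (rule wf_no_infinite_down_chainE[where f = ?g])
  ultimately show False by blast
qed

end

subsection \<open>Hamiltonian paths in subtrees\<close>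

text \<open>A Hamiltonian cycle is described up to refinement by a sequence of segments. An
  \<open>Edge\<close> is an edge of \<open>G\<^sup>2 \<box> K\<^sub>2\<close>; the other segments are placeholders for paths to be chosen
  later: \<open>Rung K v b\<close> leads from \<open>(v, b)\<close> to \<open>(v, \<not> b)\<close>, \<open>Out K v b\<close> from \<open>(v, b)\<close> to \<open>(w, b)\<close>
  for the root \<open>w\<close> of the last kid of \<open>K\<close>, and \<open>Into K v b\<close> is its reverse; each visits every vertex
  of \<open>K \<times> K\<^sub>2\<close> exactly once. \<open>Rung {v} v b\<close> is an edge already.\<close>

datatype 'a seg = Edge "'a \<times> bool" "'a \<times> bool" | Rung "'a set" 'a bool | Out "'a set" 'a bool | Into "'a set" 'a bool

context infinite_graph
begin

abbreviation F :: "'a \<times> bool \<Rightarrow> 'a \<times> bool \<Rightarrow> bool" where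
  "F \<equiv> box_K2 V (graph_square E)"

section \<open>Segments and their refinement\<close>

definition lst :: "'a set \<Rightarrow> 'a \<Rightarrow> 'a" where
  "lst K v = snd (last (kids K v))"

fun seg_src :: "'a seg \<Rightarrow> 'a \<times> bool" where
  "seg_src (Edge x y) = x"
| "seg_src (Rung K v b) = (v, b)"
| "seg_src (Out K v b) = (v, b)"
| "seg_src (Into K v b) = (lst K v, b)"

fun seg_tgt :: "'a seg \<Rightarrow> 'a \<times> bool" where
  "seg_tgt (Edge x y) = y"
| "seg_tgt (Rung K v b) = (v, \<not> b)"
| "seg_tgt (Out K v b) = (lst K v, b)"
| "seg_tgt (Into K v b) = (v, b)"

fun inner_vs :: "'a seg \<Rightarrow> ('a \<times> bool) set" where
  "inner_vs (Edge x y) = {}"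
| "inner_vs (Rung K v b) = (K - {v}) \<times> UNIV"
| "inner_vs (Out K v b) = K \<times> UNIV - {(v, b), (lst K v, b)}"
| "inner_vs (Into K v b) = K \<times> UNIV - {(v, b), (lst K v, b)}"

fun rev_seg :: "'a seg \<Rightarrow> 'a seg" where
  "rev_seg (Edge x y) = Edge y x"
| "rev_seg (Rung K v b) = Rung K v (\<not> b)"
| "rev_seg (Out K v b) = Into K v b"
| "rev_seg (Into K v b) = Out K v b"

fun valid :: "'a seg \<Rightarrow> bool" where
  "valid (Edge x y) \<longleftrightarrow> F x y"
| "valid (Rung K v b) \<longleftrightarrow> node K v"
| "valid (Out K v b) \<longleftrightarrow> node K v \<and> K \<noteq> {v}"
| "valid (Into K v b) \<longleftrightarrow> node K v \<and> K \<noteq> {v}"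

text \<open>Half-open on purpose: the target is counted and the source is not. Along a path each
  junction is counted once, so visiting every vertex once becomes disjointness of the sets
  \<open>cov s\<close>.\<close>

definition cov :: "'a seg \<Rightarrow> ('a \<times> bool) set" where
  "cov s = insert (seg_tgt s) (inner_vs s)"

definition Cov :: "'a seg list \<Rightarrow> ('a \<times> bool) set" where
  "Cov l = \<Union> (cov ` set l)"

fun linked :: "'a \<times> bool \<Rightarrow> 'a seg list \<Rightarrow> 'a \<times> bool \<Rightarrow> bool" where
  "linked x [] y \<longleftrightarrow> x = y"
| "linked x (s # l) y \<longleftrightarrow> seg_src s = x \<and> linked (seg_tgt s) l y"

fun proper :: "'a seg list \<Rightarrow> bool" where
  "proper [] \<longleftrightarrow> True"
| "proper (s # l) \<longleftrightarrow> valid s \<and> cov s \<inter> Cov l = {} \<and> proper l"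

text \<open>Two kid roots share the neighbour \<open>v\<close>, so a hop between them is an edge of
  the square. The start \<open>z\<close> is left free since a chain begins at \<open>v\<close> or at
  the root of a kid treated apart.\<close>

fun chain :: "'a \<times> bool \<Rightarrow> bool \<Rightarrow> ('a set \<times> 'a) list \<Rightarrow> 'a seg list" where
  "chain z b [] = []"
| "chain z b (p # ps) = Edge z (snd p, b) # Rung (fst p) (snd p) b # chain (snd p, \<not> b) (\<not> b) ps"

text \<open>Every \<open>Rung\<close> changes the level, so only an odd number of kids can be chained from \<open>(v, b)\<close> to
  a neighbour of \<open>(v, \<not> b)\<close>. For an even number one kid is treated apart: the two copies of a kid that
  is a single vertex enclose the rest of the chain; otherwise a kid is entered at a vertex at
  distance 2 from \<open>v\<close> and traversed without a change of level.\<close>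

definition mid :: "'a set \<Rightarrow> 'a \<Rightarrow> bool \<Rightarrow> 'a seg list" where
  "mid K v b = (let ps = kids K v; q = hd ps in
     if odd (length ps) then chain (v, b) b ps
     else if fst (last ps) = {snd (last ps)} then
       Edge (v, b) (lst K v, b) # chain (lst K v, b) b (butlast ps) @
         [Edge (snd (last (butlast ps)), \<not> b) (lst K v, \<not> b)]
     else Edge (v, b) (lst (fst q) (snd q), b) # Into (fst q) (snd q) b # chain (snd q, b) b (tl ps))"

text \<open>In \<open>Rung\<close>, \<open>mid\<close> ends at the root of the last kid on the other
  level, from where an edge returns to \<open>v\<close>. \<open>Out\<close> uses up both copies of
  \<open>v\<close> first, so \<open>mid\<close> starts on level \<open>\<not> b\<close> and ends on
  level \<open>b\<close>. The empty list marks segments that are edges already.\<close>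

fun expand :: "'a seg \<Rightarrow> 'a seg list" where
  "expand (Edge x y) = []"
| "expand (Rung K v b) = (if K = {v} then [] else mid K v b @ [Edge (lst K v, \<not> b) (v, \<not> b)])"
| "expand (Out K v b) = Edge (v, b) (v, \<not> b) # mid K v (\<not> b)"
| "expand (Into K v b) = rev (map rev_seg (Edge (v, b) (v, \<not> b) # mid K v (\<not> b)))"

section \<open>Concatenation and reversal of paths\<close>

lemma Cov_simps [simp]: "Cov [] = {}" "Cov (s # l) = cov s \<union> Cov l" "Cov (l @ l') = Cov l \<union> Cov l'"
  by (auto simp: Cov_def)

lemma linked_append: "linked x (l @ l') y \<longleftrightarrow> (\<exists>z. linked x l z \<and> linked z l' y)"
  by (induction l arbitrary: x) auto

lemma proper_append: "proper (l @ l') \<longleftrightarrow> proper l \<and> proper l' \<and> Cov l \<inter> Cov l' = {}"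
  by (induction l) auto

lemma seg_tgt_notin_inner_vs [simp]: "seg_tgt s \<notin> inner_vs s" and seg_src_notin_inner_vs [simp]: "seg_src s \<notin> inner_vs s"
  by (cases s; simp)+

lemma rev_seg_ends [simp]: "seg_src (rev_seg s) = seg_tgt s" "seg_tgt (rev_seg s) = seg_src s"
  "inner_vs (rev_seg s) = inner_vs s"
  by (cases s; auto)+

lemma linked_tgt: "linked x l y \<Longrightarrow> l \<noteq> [] \<Longrightarrow> y \<in> Cov l"
proof (induction l arbitrary: x)
  case (Cons s l)
  then show ?case using Cons.IH[of "seg_tgt s"] by (cases "l = []") (auto simp: cov_def)
qed simp

lemma F_sym: "F x y \<Longrightarrow> F y x"
  unfolding box_K2_def graph_square_def using E_sym by metis

lemma F_edge: "E x y \<Longrightarrow> F (x, b) (y, b)" and F_rung: "x \<in> V \<Longrightarrow> F (x, b) (x, \<not> b)"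
  and F_square: "E x y \<Longrightarrow> E y z \<Longrightarrow> x \<noteq> z \<Longrightarrow> F (x, b) (z, b)"
  unfolding box_K2_def graph_square_def using E_irrefl by auto

lemma valid_rev_seg [simp]: "valid (rev_seg s) = valid s"
  by (cases s) (auto intro: F_sym)

text \<open>Reversal exchanges the roles of source and target in \<open>cov\<close>, so the two
  covered sets agree only after each path's own starting point is added.\<close>

lemma rev_path:
  assumes "linked x l y" "proper l" "x \<notin> Cov l"
  shows "linked y (rev (map rev_seg l)) x \<and> proper (rev (map rev_seg l)) \<and>
    insert y (Cov (rev (map rev_seg l))) = insert x (Cov l) \<and> y \<notin> Cov (rev (map rev_seg l))"
  using assms
proof (induction l arbitrary: x)
  case (Cons s l)
  let ?r = "rev (map rev_seg l)" and ?z = "seg_tgt s"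
  have s: "seg_src s = x" "linked ?z l y" "valid s" "cov s \<inter> Cov l = {}" "proper l" "x \<notin> cov s" "x \<notin> Cov l"
    using Cons.prems by auto
  have z: "?z \<in> cov s" "?z \<notin> Cov l" using s by (auto simp: cov_def)
  have IH: "linked y ?r ?z" "proper ?r" "insert y (Cov ?r) = insert ?z (Cov l)" "y \<notin> Cov ?r"
    using Cons.IH[OF s(2,5) z(2)] by auto
  have c: "cov (rev_seg s) = insert x (inner_vs s)" "cov s = insert ?z (inner_vs s)" "?z \<notin> inner_vs s"
    using s by (auto simp: cov_def)
  have d: "cov (rev_seg s) \<inter> insert ?z (Cov l) = {}" using c s z by auto
  have y: "y \<in> insert ?z (Cov l)" and sub: "Cov ?r \<subseteq> insert ?z (Cov l)" using IH(3) by auto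
  have "insert y (Cov ?r \<union> cov (rev_seg s)) = insert x (cov s \<union> Cov l)"
    using IH(3) c by auto
  moreover have "y \<notin> Cov ?r \<union> cov (rev_seg s)" using IH(4) d y by auto
  moreover have "linked y (?r @ [rev_seg s]) x" unfolding linked_append using IH(1) s(1) by (intro exI[of _ ?z]) simp
  moreover have "proper (?r @ [rev_seg s])" unfolding proper_append using IH(2) s(3) d sub by auto
  ultimately show ?case by simp
qed simp

section \<open>Hamiltonian paths through the kids\<close>

definition kid_list :: "'a \<Rightarrow> ('a set \<times> 'a) list \<Rightarrow> bool" where
  "kid_list v ps \<longleftrightarrow> distinct ps \<and> (\<forall>p \<in> set ps. node (fst p) (snd p) \<and> E v (snd p)) \<and>
     (\<forall>p \<in> set ps. \<forall>q \<in> set ps. p \<noteq> q \<longrightarrow> fst p \<inter> fst q = {})"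

lemma node_self: "node K v \<Longrightarrow> v \<in> K" and node_V: "node K v \<Longrightarrow> K \<subseteq> V" and node_conn: "node K v \<Longrightarrow> conn K"
  by (auto simp: node_def)

lemma chain_path:
  assumes "kid_list v ps" "\<forall>p \<in> set ps. F z (snd p, b)"
  shows "linked z (chain z b ps) (if ps = [] then z else (snd (last ps), if even (length ps) then b else \<not> b)) \<and>
    proper (chain z b ps) \<and> Cov (chain z b ps) = (\<Union>p \<in> set ps. fst p \<times> UNIV)"
  using assms
proof (induction ps arbitrary: z b)
  case (Cons p ps)
  let ?c = "chain (snd p, \<not> b) (\<not> b) ps"
  have k: "kid_list v ps" "node (fst p) (snd p)" "E v (snd p)" "p \<notin> set ps"
    and k2: "\<And>q. q \<in> set ps \<Longrightarrow> fst p \<inter> fst q = {} \<and> node (fst q) (snd q) \<and> E v (snd q)"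
    using Cons.prems(1) unfolding kid_list_def by auto
  have "F (snd p, \<not> b) (snd q, \<not> b)" if "q \<in> set ps" for q
  proof -
    have "snd p \<noteq> snd q" using k2[OF that] node_self k(2) by fastforce
    then show ?thesis using F_square[of "snd p" v "snd q"] k(3) k2[OF that] E_sym by blast
  qed
  then have IH: "linked (snd p, \<not> b) ?c (if ps = [] then (snd p, \<not> b) else
        (snd (last ps), if even (length ps) then \<not> b else \<not> \<not> b))"
    "proper ?c" "Cov ?c = (\<Union>p \<in> set ps. fst p \<times> UNIV)"
    using Cons.IH[OF k(1), of "(snd p, \<not> b)" "\<not> b"] by auto
  have p: "snd p \<in> fst p" using node_self k(2) .
  have c: "cov (Edge z (snd p, b)) = {(snd p, b)}"
    "cov (Rung (fst p) (snd p) b) = fst p \<times> UNIV - {(snd p, b)}"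
    using p by (auto simp: cov_def)
  have d: "fst p \<times> UNIV \<inter> Cov ?c = {}" using IH(3) k2 by fastforce
  have "linked z (chain z b (p # ps))
     (if p # ps = [] then z else (snd (last (p # ps)), if even (length (p # ps)) then b else \<not> b))"
    using IH(1) by auto
  moreover have "proper (chain z b (p # ps))"
    using IH(2) d p k(2) Cons.prems(2) by (auto simp: c)
  moreover have "Cov (chain z b (p # ps)) = (\<Union>p \<in> set (p # ps). fst p \<times> UNIV)"
    using IH(3) p by (auto simp: c)
  ultimately show ?case by blast
qed simp

lemma kid_list_kids: assumes "node K v" shows "kid_list v (kids K v)"
  unfolding kid_list_def using kids(1,2)[of K v] kid_sets_node[OF assms] pick kid_sets_disjoint
  by auto

lemma kids_node:
  assumes "node K v" "p \<in> set (kids K v)"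
  shows "node (fst p) (snd p) \<and> E v (snd p) \<and> fst p \<subseteq> K - {v}"
proof -
  have "fst p \<in> kid_sets K v" using assms(2) by (auto simp: kids(2))
  then show ?thesis using kid_list_kids[OF assms(1)] assms(2) kid_sets_sub unfolding kid_list_def by blast
qed

lemma Union_kids: "node K v \<Longrightarrow> (\<Union>p \<in> set (kids K v). fst p) = K - {v}"
  using Union_kid_sets[of K v] node_self node_conn kids(2)[of K v] by force

lemma kids_nonempty: "node K v \<Longrightarrow> K \<noteq> {v} \<Longrightarrow> kids K v \<noteq> []"
  using Union_kids[of K v] node_self[of K v] by force

lemma kids_disjoint:
  "node K v \<Longrightarrow> p \<in> set (kids K v) \<Longrightarrow> q \<in> set (kids K v) \<Longrightarrow> p \<noteq> q \<Longrightarrow> fst p \<inter> fst q = {}"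
  using kid_list_kids[of K v] unfolding kid_list_def by blast

lemma lst_in: assumes "node K v" "K \<noteq> {v}" shows "lst K v \<in> K" "lst K v \<noteq> v" "E v (lst K v)"
proof -
  have "last (kids K v) \<in> set (kids K v)" using kids_nonempty[OF assms] by simp
  from kids_node[OF assms(1) this] show "lst K v \<in> K" "lst K v \<noteq> v" "E v (lst K v)"
    unfolding lst_def using node_self by blast+
qed

lemma kid_list_sub:
  assumes "kid_list v ps" "distinct qs" "set qs \<subseteq> set ps" shows "kid_list v qs"
  unfolding kid_list_def
proof (intro conjI ballI impI)
  fix p assume "p \<in> set qs"
  then have p: "p \<in> set ps" using assms(3) by (rule subsetD[rotated])
  show "node (fst p) (snd p)" "E v (snd p)" using assms(1) p by (simp_all add: kid_list_def)
  fix q assume "q \<in> set qs" "p \<noteq> q"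
  then show "fst p \<inter> fst q = {}"
    using assms(1) p subsetD[OF assms(3), of q] by (simp add: kid_list_def)
qed (rule assms(2))

lemma mid_path:
  assumes n: "node K v" and ne: "K \<noteq> {v}"
  shows "linked (v, b) (mid K v b) (lst K v, \<not> b) \<and> proper (mid K v b) \<and>
    Cov (mid K v b) = (K - {v}) \<times> UNIV \<and> mid K v b \<noteq> []"
proof -
  let ?ps = "kids K v" and ?l = "lst K v"
  have ps: "?ps \<noteq> []" by (rule kids_nonempty[OF n ne])
  have kl: "kid_list v ?ps" by (rule kid_list_kids[OF n])
  have kn: "\<And>p. p \<in> set ?ps \<Longrightarrow> node (fst p) (snd p) \<and> E v (snd p)" using kl by (simp add: kid_list_def)
  have U: "(\<Union>p \<in> set ?ps. fst p \<times> (UNIV :: bool set)) = (K - {v}) \<times> UNIV"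
    using Union_kids[OF n] by blast
  have sib: "F (snd p, b') (snd q, b')" if "p \<in> set ?ps" "q \<in> set ?ps" "p \<noteq> q" for p q b'
  proof -
    have "snd p \<noteq> snd q" using kids_disjoint[OF n that] kn that node_self by (metis disjoint_iff)
    then show ?thesis using F_square[of "snd p" v "snd q"] kn that E_sym by blast
  qed
  consider (odd) "odd (length ?ps)"
    | (leaf) "even (length ?ps)" "fst (last ?ps) = {snd (last ?ps)}"
    | (other) "even (length ?ps)" "fst (last ?ps) \<noteq> {snd (last ?ps)}" by blast
  then show ?thesis
  proof cases
    case odd
    then have m: "mid K v b = chain (v, b) b ?ps" by (simp add: mid_def Let_def)
    show ?thesis unfolding m using chain_path[OF kl, of "(v, b)" b] kn F_edge odd U ps
      by (cases ?ps) (auto simp: lst_def)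
  next
    case leaf
    \<comment> \<open>The two copies of the single-vertex kid open and close the path; the odd
      number of kids between them accounts for the change of level.\<close>
    let ?qs = "butlast ?ps" and ?c = "last ?ps"
    let ?ch = "chain (?l, b) b ?qs" and ?r = "Edge (snd (last ?qs), \<not> b) (?l, \<not> b)"
    have m: "mid K v b = Edge (v, b) (?l, b) # ?ch @ [?r]"
      using leaf by (simp add: mid_def Let_def)
    have app: "?qs @ [?c] = ?ps" using ps by simp
    have oq: "odd (length ?qs)" using leaf(1) ps by (cases "length ?ps") auto
    then have qs: "?qs \<noteq> []" by (metis even_zero list.size(3))
    have dist: "distinct (?qs @ [?c])" using app kl by (simp add: kid_list_def)
    have sq3: "set ?ps = insert ?c (set ?qs)" using arg_cong[OF app, of set] by simp
    then have sq: "set ?qs \<subseteq> set ?ps" "?c \<in> set ?ps" "set ?ps = insert ?c (set ?qs)" "?c \<notin> set ?qs"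
      using dist by (simp_all add: subset_insertI)
    have klq: "kid_list v ?qs" using kid_list_sub[OF kl _ sq(1)] dist by simp
    have qsD: "p \<in> set ?ps" "p \<noteq> ?c" if "p \<in> set ?qs" for p using sq(1,4) that by blast+
    then have "\<forall>p \<in> set ?qs. F (?l, b) (snd p, b)" unfolding lst_def by (metis sib[OF sq(2)])
    note cp = chain_path[OF klq this]
    have lq: "last ?qs \<in> set ?qs" using qs by simp
    have cc: "fst ?c \<times> (UNIV :: bool set) = {(?l, b), (?l, \<not> b)}"
      using leaf(2) unfolding lst_def by (auto simp: UNIV_bool)
    have disj: "Cov ?ch \<inter> {(?l, b), (?l, \<not> b)} = {}"
      unfolding cc[symmetric] using cp kids_disjoint[OF n sq(2)] qsD by fastforce
    have "F (snd (last ?qs), b') (?l, b')" for b'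
      using sib[OF qsD(1)[OF lq] sq(2) qsD(2)[OF lq]] unfolding lst_def .
    moreover have "F (v, b) (?l, b)" using kn[OF sq(2)] F_edge unfolding lst_def by blast
    moreover have "Cov (mid K v b) = (K - {v}) \<times> UNIV"
      unfolding m U[symmetric] sq(3) using cp cc by (auto simp: cov_def)
    ultimately show ?thesis unfolding m using cp oq qs disj
      by (auto simp: linked_append proper_append cov_def)
  next
    case other
    \<comment> \<open>\<open>?m\<close> is a grandchild of \<open>v\<close>, hence adjacent to it in
      the square. \<open>Into\<close> ends at the root of the first kid on the same level, and an
      odd number of kids remains for the chain.\<close>
    let ?q = "hd ?ps" and ?qs = "tl ?ps"
    let ?m = "lst (fst ?q) (snd ?q)"
    have m: "mid K v b = Edge (v, b) (?m, b) # Into (fst ?q) (snd ?q) b # chain (snd ?q, b) b ?qs"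
      using other by (simp add: mid_def Let_def)
    have app: "?ps = ?q # ?qs" using ps by simp
    have oq: "odd (length ?qs)" using other ps by (cases ?ps) auto
    then have qs: "?qs \<noteq> []" by (metis even_zero list.size(3))
    have dist: "distinct (?q # ?qs)" using app kl by (simp add: kid_list_def)
    have sq3: "set ?ps = insert ?q (set ?qs)" using arg_cong[OF app, of set] by simp
    then have sq: "set ?qs \<subseteq> set ?ps" "?q \<in> set ?ps" "set ?ps = insert ?q (set ?qs)" "?q \<notin> set ?qs"
      using dist by (simp_all add: subset_insertI)
    have klq: "kid_list v ?qs" using kid_list_sub[OF kl _ sq(1)] dist by simp
    have qsD: "p \<in> set ?ps" "p \<noteq> ?q" if "p \<in> set ?qs" for p using sq(1,4) that by blast+
    then have "\<forall>p \<in> set ?qs. F (snd ?q, b) (snd p, b)" by (metis sib[OF sq(2)])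
    note cp = chain_path[OF klq this]
    have ll: "last ?qs = last ?ps" using app qs by (metis last_ConsR)
    have nq: "node (fst ?q) (snd ?q)" "E v (snd ?q)" using kn[OF sq(2)] by auto
    have neq: "fst ?q \<noteq> {snd ?q}" using kids(3)[OF sq(2)] other(2) by blast
    note lm = lst_in[OF nq(1) neq]
    have "?m \<noteq> v" using lm(1) kids_node[OF n sq(2)] by blast
    then have f: "F (v, b) (?m, b)" using F_square[OF nq(2) lm(3)] by simp
    let ?ch = "chain (snd ?q, b) b ?qs"
    have cc: "cov (Edge (v, b) (?m, b)) = {(?m, b)}"
      "cov (Into (fst ?q) (snd ?q) b) = fst ?q \<times> UNIV - {(?m, b)}"
      using lm node_self[OF nq(1)] by (auto simp: cov_def)
    have C: "Cov (mid K v b) = (K - {v}) \<times> UNIV"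
      unfolding m U[symmetric] sq(3) Cov_simps cc using cp lm by auto
    have d: "fst ?q \<times> UNIV \<inter> Cov ?ch = {}"
      using cp kids_disjoint[OF n sq(2)] qsD by fastforce
    have "linked (snd ?q, b) ?ch (lst K v, \<not> b)" using cp oq qs ll by (simp add: lst_def)
    then have L: "linked (v, b) (mid K v b) (lst K v, \<not> b)" unfolding m by simp
    have "(?m, b) \<notin> Cov ?ch" "(fst ?q \<times> UNIV - {(?m, b)}) \<inter> Cov ?ch = {}" using d lm(1) by blast+
    then have "proper (mid K v b)" unfolding m proper.simps valid.simps Cov_simps cc
      using f nq(1) neq cp by blast
    then show ?thesis using L C m by simp
  qed
qed

text \<open>The clause on \<open>tl\<close> says that an expansion has at least two segments, so
  that \<open>split_path\<close> yields two nonempty halves.\<close>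

lemma expand_path:
  assumes v: "valid s" and ne: "expand s \<noteq> []"
  shows "linked (seg_src s) (expand s) (seg_tgt s) \<and> proper (expand s) \<and> Cov (expand s) = cov s \<and>
    tl (expand s) \<noteq> []"
proof -
  have B: "linked (v, b) (expand (Out K v b)) (lst K v, b) \<and> proper (expand (Out K v b)) \<and>
      Cov (expand (Out K v b)) = K \<times> UNIV - {(v, b)} \<and> tl (expand (Out K v b)) \<noteq> []"
    if n: "node K v" "K \<noteq> {v}" for K v b
    using mid_path[OF n, of "\<not> b"] node_self[OF n(1)] node_V[OF n(1)] F_rung[of v b]
    by (auto simp: cov_def)
  show ?thesis
  proof (cases s)
    case (Edge x y)
    then show ?thesis using ne by simp
  next
    case (Rung K v b)
    then have n: "node K v" "K \<noteq> {v}" using v ne by auto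
    have "F (lst K v, \<not> b) (v, \<not> b)" using lst_in[OF n] F_edge E_sym by blast
    moreover have "tl (mid K v b @ [Edge (lst K v, \<not> b) (v, \<not> b)]) \<noteq> []"
      using mid_path[OF n, of b] by (cases "mid K v b") auto
    ultimately show ?thesis using mid_path[OF n, of b] n
      by (auto simp: Rung linked_append proper_append cov_def)
  next
    case (Out K v b)
    then have n: "node K v" "K \<noteq> {v}" using v by auto
    then show ?thesis using B[OF n, of b] lst_in[OF n] by (auto simp: Out cov_def)
  next
    case (Into K v b)
    then have n: "node K v" "K \<noteq> {v}" using v by auto
    note Bn = B[OF n, of b]
    have e: "expand s = rev (map rev_seg (expand (Out K v b)))" by (simp add: Into)
    have "(v, b) \<notin> Cov (expand (Out K v b))" using Bn by auto
    with Bn have r: "linked (lst K v, b) (expand s) (v, b)" "proper (expand s)"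
        "insert (lst K v, b) (Cov (expand s)) = insert (v, b) (K \<times> UNIV - {(v, b)})"
        "(lst K v, b) \<notin> Cov (expand s)"
      using rev_path[of "(v, b)" "expand (Out K v b)" "(lst K v, b)"] unfolding e by auto
    have "Cov (expand s) = insert (v, b) (K \<times> UNIV - {(v, b)}) - {(lst K v, b)}" using r(3,4) by blast
    also have "\<dots> = cov s" using lst_in[OF n] node_self[OF n(1)] by (auto simp: Into cov_def)
    finally have "Cov (expand s) = cov s" .
    moreover have "length (expand s) = length (expand (Out K v b))" unfolding e by simp
    then have "tl (expand s) \<noteq> []" using Bn by (metis Nil_tl length_0_conv length_tl)
    ultimately show ?thesis using r by (simp add: Into)
  qed
qed

section \<open>Binary splitting of paths\<close>

text \<open>Peeling off one segment at a time makes the refinement binary. A single segment is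
  expanded and peeled in the same step, so every split happens at a genuine inner vertex.\<close>

fun split_path :: "'a seg list \<Rightarrow> ('a seg list \<times> 'a seg list) option" where
  "split_path [] = None"
| "split_path [s] = (case expand s of [] \<Rightarrow> None | s' # l \<Rightarrow> Some ([s'], l))"
| "split_path (s # s' # l) = Some ([s], s' # l)"

definition path_src :: "'a seg list \<Rightarrow> 'a \<times> bool" where
  "path_src l = seg_src (hd l)"

definition path_tgt :: "'a seg list \<Rightarrow> 'a \<times> bool" where
  "path_tgt l = seg_tgt (last l)"

definition interior_vs :: "'a seg list \<Rightarrow> ('a \<times> bool) set" where
  "interior_vs l = Cov l - {path_tgt l}"

text \<open>Since \<open>interior_vs\<close> omits the target, the last condition still admits a
  path whose source and target agree, as the outermost one does.\<close>

definition good_path :: "'a seg list \<Rightarrow> bool" where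
  "good_path l \<longleftrightarrow> l \<noteq> [] \<and> proper l \<and> linked (path_src l) l (path_tgt l) \<and> path_src l \<notin> interior_vs l"

lemma linked_path: "linked x l y \<Longrightarrow> l \<noteq> [] \<Longrightarrow> path_src l = x \<and> path_tgt l = y"
  by (induction l arbitrary: x) (auto simp: path_src_def path_tgt_def neq_Nil_conv)

lemma split_path_cases:
  assumes g: "good_path k" and s: "split_path k = Some (k1, k2)"
  obtains s where "k1 = [s]" "k2 \<noteq> []" "proper (s # k2)" "linked (path_src k) (s # k2) (path_tgt k)"
    "Cov (s # k2) = Cov k" "path_src k \<notin> Cov k - {path_tgt k}"
    "s # k2 = k \<or> (\<exists>s'. k = [s'] \<and> expand s' = s # k2)"
  using s
proof (cases k rule: split_path.cases)
  case (2 s')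
  then obtain s where e: "expand s' = s # k2" "k1 = [s]" using s by (auto split: list.splits)
  have v: "valid s'" using g 2 by (simp add: good_path_def)
  have k: "path_src k = seg_src s'" "path_tgt k = seg_tgt s'" "Cov k = cov s'"
    using 2 by (simp_all add: path_src_def path_tgt_def)
  have ep: "linked (seg_src s') (s # k2) (seg_tgt s')" "proper (s # k2)" "Cov (s # k2) = cov s'" "k2 \<noteq> []"
    using expand_path[OF v] e(1) by simp_all
  show thesis
    by (rule that[of s]) (use ep e k 2 g in \<open>simp_all add: good_path_def interior_vs_def\<close>)
next
  case (3 s s' l)
  then have k: "k1 = [s]" "s # k2 = k" using s by simp_all
  show thesis
    by (rule that[of s]) (use k 3 g in \<open>simp_all only: good_path_def interior_vs_def, auto\<close>)
qed simp

lemma good_split_path: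
  assumes g: "good_path k" and s: "split_path k = Some (k1, k2)"
  shows "good_path k1 \<and> good_path k2 \<and> path_src k1 = path_src k \<and> path_src k2 = path_tgt k1 \<and> path_tgt k2 = path_tgt k"
    "interior_vs k = insert (path_tgt k1) (interior_vs k1 \<union> interior_vs k2) \<and> interior_vs k1 \<inter> interior_vs k2 = {} \<and>
      path_tgt k1 \<notin> interior_vs k1 \<union> interior_vs k2"
proof -
  obtain s where k: "k1 = [s]" "k2 \<noteq> []" "proper (s # k2)" "linked (path_src k) (s # k2) (path_tgt k)"
    "Cov (s # k2) = Cov k" "path_src k \<notin> Cov k - {path_tgt k}"
    by (rule split_path_cases[OF g s])
  have l2: "linked (seg_tgt s) k2 (path_tgt k)" and ss: "seg_src s = path_src k" using k(4) by auto
  have p2: "path_src k2 = seg_tgt s" "path_tgt k2 = path_tgt k" using linked_path[OF l2 k(2)] by auto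
  have p1: "path_src k1 = seg_src s" "path_tgt k1 = seg_tgt s" using k(1) by (auto simp: path_src_def path_tgt_def)
  have pr: "valid s" "proper k2" "cov s \<inter> Cov k2 = {}" using k(3) by auto
  have t: "path_tgt k \<in> Cov k2" by (rule linked_tgt[OF l2 k(2)])
  have i1: "interior_vs k1 = inner_vs s" unfolding interior_vs_def p1 using k(1) by (simp add: cov_def)
  have i2: "interior_vs k2 = Cov k2 - {path_tgt k}" by (simp add: interior_vs_def p2)
  have "good_path k1" using k(1) pr p1 i1 unfolding good_path_def by auto
  moreover have "good_path k2" using k(2) pr p2 l2 i2 unfolding good_path_def by (auto simp: cov_def)
  ultimately show "good_path k1 \<and> good_path k2 \<and> path_src k1 = path_src k \<and> path_src k2 = path_tgt k1 \<and> path_tgt k2 = path_tgt k"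
    using p1 p2 ss by simp
  show "interior_vs k = insert (path_tgt k1) (interior_vs k1 \<union> interior_vs k2) \<and> interior_vs k1 \<inter> interior_vs k2 = {} \<and>
      path_tgt k1 \<notin> interior_vs k1 \<union> interior_vs k2"
    unfolding i1 i2 p1 using k(5) pr(3) t by (auto simp: interior_vs_def cov_def)
qed

lemma good_leaf_path:
  assumes "good_path k" "split_path k = None"
  shows "F (path_src k) (path_tgt k) \<and> interior_vs k = {}"
proof -
  obtain s where k: "k = [s]" "expand s = []"
    using assms by (cases k rule: split_path.cases) (auto simp: good_path_def split: list.splits)
  have v: "valid s" using assms(1) k by (simp add: good_path_def)
  have i: "interior_vs k = inner_vs s" using k by (auto simp: interior_vs_def path_tgt_def cov_def)
  have p: "path_src k = seg_src s" "path_tgt k = seg_tgt s" using k by (auto simp: path_src_def path_tgt_def)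
  show ?thesis
  proof (cases s)
    case (Rung K w b)
    then have "node {w} w" "K = {w}" using v k(2) by (auto split: if_splits)
    then show ?thesis using Rung i p F_rung[of w b] node_V by auto
  qed (use v k i p in auto)
qed

lemma cov_sub: assumes "valid s" shows "insert (seg_src s) (cov s) \<subseteq> V \<times> UNIV"
proof (cases s)
  case (Edge x y)
  then show ?thesis using assms E_V by (cases x; cases y) (auto simp: cov_def box_K2_def graph_square_def)
next
  case (Rung K v b)
  then show ?thesis using assms node_V[of K v] node_self[of K v] by (auto simp: cov_def)
next
  case (Out K v b)
  then show ?thesis using assms node_V[of K v] node_self[of K v] lst_in[of K v] by (auto simp: cov_def)
next
  case (Into K v b)
  then show ?thesis using assms node_V[of K v] node_self[of K v] lst_in[of K v] by (auto simp: cov_def)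
qed

lemma proper_valid: "proper l \<Longrightarrow> s \<in> set l \<Longrightarrow> valid s"
  by (induction l) auto

lemma good_path_ends:
  assumes "good_path k"
  shows "path_src k \<notin> interior_vs k \<and> path_tgt k \<notin> interior_vs k \<and>
    insert (path_src k) (insert (path_tgt k) (interior_vs k)) \<subseteq> V \<times> UNIV"
proof -
  have v: "valid s" if "s \<in> set k" for s using assms proper_valid that by (auto simp: good_path_def)
  have ne: "k \<noteq> []" using assms by (simp add: good_path_def)
  have "Cov k \<subseteq> V \<times> UNIV" using cov_sub v unfolding Cov_def by blast
  moreover have "path_tgt k \<in> Cov k" using ne unfolding Cov_def path_tgt_def cov_def by fastforce
  moreover have "path_src k \<in> V \<times> UNIV" using cov_sub[OF v[of "hd k"]] ne by (auto simp: path_src_def)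
  moreover have "path_src k \<notin> interior_vs k" using assms by (simp add: good_path_def)
  ultimately show ?thesis unfolding interior_vs_def by blast
qed

end

subsection \<open>Boundaries, termination and branches\<close>

context infinite_graph
begin

section \<open>Finite boundaries in the product\<close>

definition fin_bd :: "('a \<times> bool) set \<Rightarrow> bool" where
  "fin_bd A \<longleftrightarrow> finite {(x, y). F x y \<and> x \<in> A \<and> y \<notin> A}"

lemma finite_F_nbrs: "finite {y. F x y}"
proof -
  have "{y. F x y} \<subseteq> ({y. E (fst x) y} \<union> (\<Union>w \<in> {w. E (fst x) w}. {y. E w y}) \<union> {fst x}) \<times> UNIV"
    by (auto simp: box_K2_def graph_square_def)
  then show ?thesis by (rule finite_subset) (simp add: finite_nbrs)
qed

lemma finite_F_nbrs': "finite {x. F x y}"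
  using finite_F_nbrs[of y] F_sym by (metis (mono_tags, lifting) Collect_cong)

lemma fin_bd_insert:
  assumes "fin_bd A" shows "fin_bd (insert a A)"
proof -
  have "{(x, y). F x y \<and> x \<in> insert a A \<and> y \<notin> insert a A} \<subseteq>
      {(x, y). F x y \<and> x \<in> A \<and> y \<notin> A} \<union> Pair a ` {y. F a y}" by auto
  then show ?thesis using assms finite_F_nbrs unfolding fin_bd_def by (meson finite_UnI finite_imageI finite_subset)
qed

lemma fin_bd_remove:
  assumes "fin_bd A" shows "fin_bd (A - {a})"
proof -
  have "{(x, y). F x y \<and> x \<in> A - {a} \<and> y \<notin> A - {a}} \<subseteq>
      {(x, y). F x y \<and> x \<in> A \<and> y \<notin> A} \<union> (\<lambda>x. (x, a)) ` {x. F x a}" by auto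
  then show ?thesis using assms finite_F_nbrs' unfolding fin_bd_def by (meson finite_UnI finite_imageI finite_subset)
qed

lemma fin_bd_Un:
  assumes "fin_bd A" "fin_bd B" shows "fin_bd (A \<union> B)"
proof -
  have "{(x, y). F x y \<and> x \<in> A \<union> B \<and> y \<notin> A \<union> B} \<subseteq>
      {(x, y). F x y \<and> x \<in> A \<and> y \<notin> A} \<union> {(x, y). F x y \<and> x \<in> B \<and> y \<notin> B}" by auto
  then show ?thesis using assms unfolding fin_bd_def by (meson finite_UnI finite_subset)
qed

text \<open>An edge leaving \<open>K \<times> UNIV\<close> keeps its level and comes from a path of
  at most two edges of \<open>E\<close>, one of which crosses the boundary of \<open>K\<close>.
  There are finitely many crossing edges, and the other edge is incident to one of them, at a vertex
  of finite degree.\<close>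

lemma fin_bd_node:
  assumes "node K v" shows "fin_bd (K \<times> UNIV)"
proof -
  let ?D = "{(x, y). E x y \<and> x \<in> K \<and> y \<notin> K}"
  let ?P = "?D \<union> (\<Union>(w, y) \<in> ?D. (\<lambda>x. (x, y)) ` {x. E w x}) \<union> (\<Union>(x, w) \<in> ?D. Pair x ` {y. E w y})"
  have D: "finite ?D" using assms by (simp add: node_def)
  have sq: "(x, y) \<in> ?P" if xy: "graph_square E x y" "x \<in> K" "y \<notin> K" for x y
  proof -
    consider "E x y" | w where "E x w" "E w y" using xy(1) unfolding graph_square_def by blast
    then show ?thesis
    proof cases
      case 2
      show ?thesis
      proof (cases "w \<in> K")
        case True
        then have "(w, y) \<in> ?D" "(x, y) \<in> (\<lambda>x. (x, y)) ` {x. E w x}" using 2 xy E_sym by auto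
        then show ?thesis by blast
      next
        case False
        then have "(x, w) \<in> ?D" "(x, y) \<in> Pair x ` {y. E w y}" using 2 xy by auto
        then show ?thesis by blast
      qed
    qed (use xy in auto)
  qed
  have "{(x, y). F x y \<and> x \<in> K \<times> UNIV \<and> y \<notin> K \<times> UNIV} \<subseteq>
      (\<Union>b. (\<lambda>(x, y). ((x, b), (y, b))) ` ?P)"
  proof
    fix e assume "e \<in> {(x, y). F x y \<and> x \<in> K \<times> UNIV \<and> y \<notin> K \<times> UNIV}"
    then obtain x b y c where e: "e = ((x, b), (y, c))" "F (x, b) (y, c)" "x \<in> K" "y \<notin> K" by auto
    then have "c = b" "graph_square E x y" by (auto simp: box_K2_def)
    then have "(x, y) \<in> ?P" using sq e by blast
    then show "e \<in> (\<Union>b. (\<lambda>(x, y). ((x, b), (y, b))) ` ?P)"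
      using e(1) \<open>c = b\<close> by (intro UN_I[of b] image_eqI[of _ _ "(x, y)"]) simp_all
  qed
  moreover have "finite ?P"
    by (intro finite_UnI finite_UN_I D) (auto simp: finite_nbrs D)
  ultimately show ?thesis unfolding fin_bd_def by (meson finite_UN_I finite_imageI finite_subset finite)
qed

lemma fin_bd_inner_vs: assumes "valid s" shows "fin_bd (inner_vs s)"
proof (cases s)
  case (Edge x y) then show ?thesis by (simp add: fin_bd_def)
next
  case (Rung K v b)
  have "(K - {v}) \<times> UNIV = K \<times> UNIV - {(v, True)} - {(v, False)}" by (auto simp: UNIV_bool)
  then show ?thesis using Rung fin_bd_node fin_bd_remove assms by simp
next
  case (Out K v b)
  have "K \<times> UNIV - {(v, b), (lst K v, b)} = K \<times> UNIV - {(v, b)} - {(lst K v, b)}" by auto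
  then show ?thesis unfolding Out inner_vs.simps by (simp only:) (intro fin_bd_remove fin_bd_node[of K v], use assms Out in simp)
next
  case (Into K v b)
  have "K \<times> UNIV - {(v, b), (lst K v, b)} = K \<times> UNIV - {(v, b)} - {(lst K v, b)}" by auto
  then show ?thesis unfolding Into inner_vs.simps by (simp only:) (intro fin_bd_remove fin_bd_node[of K v], use assms Into in simp)
qed

lemma finite_boundary_path:
  assumes "good_path k" shows "finite {x \<in> interior_vs k. \<exists>y. F x y \<and> y \<notin> interior_vs k}"
proof -
  have "fin_bd (Cov l)" if "proper l" for l
    using that
  proof (induction l)
    case (Cons s l)
    then show ?case using fin_bd_Un fin_bd_insert fin_bd_inner_vs by (simp add: cov_def)
  qed (simp add: fin_bd_def)
  then have "fin_bd (interior_vs k)"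
    using assms fin_bd_remove by (simp add: good_path_def interior_vs_def)
  then have "finite (fst ` {(x, y). F x y \<and> x \<in> interior_vs k \<and> y \<notin> interior_vs k})"
    unfolding fin_bd_def by (rule finite_imageI)
  then show ?thesis by (rule rev_finite_subset) force
qed

section \<open>Termination of leftmost and rightmost descents\<close>

abbreviation (input) left_step :: "'a seg list \<Rightarrow> 'a seg list option" where
  "left_step \<equiv> \<lambda>k. map_option fst (split_path k)"

abbreviation (input) right_step :: "'a seg list \<Rightarrow> 'a seg list option" where
  "right_step \<equiv> \<lambda>k. map_option snd (split_path k)"

lemma left_step_seg: "terminates left_step [s']
    \<Longrightarrow> expand s \<noteq> [] \<Longrightarrow> hd (expand s) = s' \<Longrightarrow> terminates left_step [s]"
  by (rule terminatesI) (auto split: list.splits)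

lemma terminates_Edge: "expand s = [] \<Longrightarrow> terminates left_step [s]" "expand s = [] \<Longrightarrow> terminates right_step [s]"
  by (rule terminatesI, simp)+

lemma hd_mid: assumes "node K v" "K \<noteq> {v}" shows "\<exists>x y. hd (mid K v b) = Edge x y"
  using kids_nonempty[OF assms] by (cases "kids K v") (auto simp: mid_def Let_def)

lemma last_chain: "ps \<noteq> [] \<Longrightarrow> \<exists>K v b'. last (chain z b ps) = Rung K v b'"
proof (induction ps arbitrary: z b)
  case (Cons p ps)
  show ?case
  proof (cases ps)
    case (Cons q qs)
    then show ?thesis using Cons.IH[of "(snd p, \<not> b)" "\<not> b"] by simp
  qed simp
qed simp

text \<open>That \<open>mid\<close> never ends in \<open>Out\<close> or \<open>Into\<close> yields
  termination. The last piece of \<open>Out\<close>, and likewise the first piece of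
  \<open>Into\<close>, is an edge or a \<open>Rung\<close>; a nontrivial \<open>Rung\<close> begins
  and ends with an edge.\<close>

lemma last_mid:
  assumes "node K v" "K \<noteq> {v}"
  shows "(\<exists>x y. last (mid K v b) = Edge x y) \<or> (\<exists>K' w c. last (mid K v b) = Rung K' w c)"
proof -
  let ?ps = "kids K v"
  have ps: "?ps \<noteq> []" by (rule kids_nonempty[OF assms])
  have "chain z b qs \<noteq> []" if "qs \<noteq> []" for z b and qs :: "('a set \<times> 'a) list"
    using that by (cases qs) auto
  moreover have "tl ?ps \<noteq> []" if "even (length ?ps)"
    using that ps by (cases ?ps) auto
  ultimately show ?thesis using last_chain ps by (auto simp: mid_def Let_def)
qed

lemma left_Rung:
  assumes "node K v" shows "terminates left_step [Rung K v b]"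
proof (cases "K = {v}")
  case False
  obtain x y where "hd (mid K v b) = Edge x y" using hd_mid[OF assms False] by blast
  then show ?thesis using mid_path[OF assms False, of b] False
    by (intro left_step_seg[OF terminates_Edge(1)[of "Edge x y"]]) simp_all
qed (simp add: terminates_Edge)

lemma left_Into:
  assumes "node K v" "K \<noteq> {v}" shows "terminates left_step [Into K v b]"
proof -
  have m: "mid K v (\<not> b) \<noteq> []" using mid_path[OF assms] by blast
  have h: "hd (expand (Into K v b)) = rev_seg (last (mid K v (\<not> b)))"
    using m by (simp add: hd_append hd_rev last_map)
  have v: "valid (last (mid K v (\<not> b)))"
    using mid_path[OF assms, of "\<not> b"] proper_valid last_in_set m by blast
  have "terminates left_step [rev_seg (last (mid K v (\<not> b)))]"
    using last_mid[OF assms, of "\<not> b"] v by (auto intro: terminates_Edge left_Rung)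
  then show ?thesis by (rule left_step_seg) (use h in simp_all)
qed

lemma left_terminates_seg: "valid s \<Longrightarrow> terminates left_step [s]"
proof (cases s)
  case (Out K v b)
  then show ?thesis by (intro left_step_seg[OF terminates_Edge(1)[of "Edge (v, b) (v, \<not> b)"]]) simp_all
qed (auto intro: left_Rung left_Into terminates_Edge)

lemma left_terminates_path: "good_path k \<Longrightarrow> terminates left_step k"
proof (cases k rule: split_path.cases)
  case (3 s s' l)
  assume "good_path k"
  then have "valid s" using 3 by (simp add: good_path_def)
  show ?thesis
  proof (rule terminatesI)
    fix k' assume "left_step k = Some k'"
    then have "k' = [s]" using 3 by simp
    then show "terminates left_step k'" using left_terminates_seg \<open>valid s\<close> by simp
  qed
qed (auto simp: good_path_def intro: left_terminates_seg)

lemma right_terminates_last: "l \<noteq> [] \<Longrightarrow> terminates right_step [last l] \<Longrightarrow> terminates right_step l"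
proof (induction l)
  case (Cons s l)
  show ?case
  proof (cases l)
    case Nil
    then show ?thesis using Cons.prems by simp
  next
    case l: (Cons s' l')
    show ?thesis
    proof (rule terminatesI)
      fix k' assume "right_step (s # l) = Some k'"
      then have "k' = l" using l by simp
      moreover have "last (s # l) = last l" "l \<noteq> []" using l by simp_all
      ultimately show "terminates right_step k'" using Cons by metis
    qed
  qed
qed simp

lemma right_step_seg:
  assumes "terminates right_step [last (expand s)]" "valid s"
  shows "terminates right_step [s]"
proof (rule terminatesI)
  fix k' assume "right_step [s] = Some k'"
  then have e: "expand s \<noteq> []" "k' = tl (expand s)" by (auto split: list.splits)
  then have "k' \<noteq> []" using expand_path[OF assms(2)] by simp
  moreover have "last k' = last (expand s)" using e \<open>k' \<noteq> []\<close> by (simp add: last_tl)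
  ultimately show "terminates right_step k'" using assms(1) right_terminates_last by metis
qed

lemma right_Rung:
  assumes "node K v" shows "terminates right_step [Rung K v b]"
proof (cases "K = {v}")
  case False
  then show ?thesis using assms by (simp add: right_step_seg terminates_Edge)
qed (simp add: terminates_Edge)

lemma right_terminates_seg: "valid s \<Longrightarrow> terminates right_step [s]"
proof (cases s)
  case (Out K v b)
  assume v: "valid s"
  then have n: "node K v" "K \<noteq> {v}" using Out by auto
  have m: "mid K v (\<not> b) \<noteq> []" using mid_path[OF n] by blast
  have "valid (last (mid K v (\<not> b)))"
    using mid_path[OF n, of "\<not> b"] proper_valid last_in_set m by blast
  then have "terminates right_step [last (expand s)]"
    using last_mid[OF n, of "\<not> b"] Out m by (auto intro: terminates_Edge right_Rung)
  then show ?thesis using v by (rule right_step_seg)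
next
  case (Into K v b)
  assume v: "valid s"
  have "terminates right_step [last (expand s)]" using Into by (simp add: terminates_Edge)
  then show ?thesis using v by (rule right_step_seg)
qed (auto intro: right_Rung terminates_Edge)

lemma right_terminates_path: "good_path k \<Longrightarrow> terminates right_step k"
  by (rule right_terminates_last[OF _ right_terminates_seg]) (auto simp: good_path_def intro: proper_valid)

section \<open>Infinite branches follow the tree\<close>

fun over :: "'a seg \<Rightarrow> 'a set \<Rightarrow> 'a \<Rightarrow> bool" where
  "over (Edge x y) K v \<longleftrightarrow> False"
| "over (Rung K' v' b) K v \<longleftrightarrow> K = K' \<and> v = v'"
| "over (Out K' v' b) K v \<longleftrightarrow> K = K' \<and> v = v'"
| "over (Into K' v' b) K v \<longleftrightarrow> K = K' \<and> v = v'"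

lemma over_rev_seg [simp]: "over (rev_seg s) K v = over s K v"
  by (cases s) auto

lemma over_chain: "s \<in> set (chain z b ps) \<Longrightarrow> over s K v \<Longrightarrow> (K, v) \<in> set ps"
  by (induction ps arbitrary: z b) auto

lemma over_mid: assumes "s \<in> set (mid K v b)" "over s K' v'" "kids K v \<noteq> []" shows "(K', v') \<in> set (kids K v)"
proof -
  let ?ps = "kids K v"
  let ?q = "hd ?ps"
  have "s \<in> set (chain (v, b) b ?ps) \<or> s \<in> set (chain (lst K v, b) b (butlast ?ps)) \<or>
      s \<in> set (chain (snd ?q, b) b (tl ?ps)) \<or> s = Into (fst ?q) (snd ?q) b \<or> (\<exists>x y. s = Edge x y)"
    using assms(1) by (auto simp only: mid_def Let_def set_append list.set Un_iff insert_iff empty_iff split: if_splits)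
  then show ?thesis
  proof (elim disjE)
    assume "s \<in> set (chain (lst K v, b) b (butlast ?ps))"
    then show ?thesis using over_chain[OF _ assms(2)] in_set_butlastD by metis
  next
    assume "s \<in> set (chain (snd ?q, b) b (tl ?ps))"
    then show ?thesis using over_chain[OF _ assms(2)] list.set_sel(2)[OF assms(3)] by metis
  qed (use assms over_chain in auto)
qed

lemma over_expand:
  assumes "over s K v" "s' \<in> set (expand s)" "over s' K' v'" "kids K v \<noteq> []"
  shows "(K', v') \<in> set (kids K v)"
  using assms over_mid[OF _ _ assms(4)] by (cases s) (auto split: if_splits)

lemma over_node: "valid s \<Longrightarrow> over s K v \<Longrightarrow> node K v"
  by (cases s) auto

lemma expand_over: "valid s \<Longrightarrow> expand s \<noteq> [] \<Longrightarrow> \<exists>K v. over s K v \<and> node K v \<and> K \<noteq> {v}"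
  by (cases s) (auto split: if_splits)

lemma reach_lift:
  assumes "(adj K)\<^sup>*\<^sup>* x y" "K \<subseteq> V" "K \<times> UNIV \<inter> S = {}"
  shows "reach_avoid (V \<times> UNIV) F S (x, b) (y, b)"
  using assms(1)
proof (induction rule: rtranclp_induct)
  case base then show ?case by (simp add: reach_avoid_def)
next
  case (step y z)
  then have "F (y, b) (z, b)" "y \<in> K" "z \<in> K" using F_edge by (auto simp: adj_def)
  then have "F (y, b) (z, b) \<and> (y, b) \<in> V \<times> UNIV \<and> (z, b) \<in> V \<times> UNIV \<and> (y, b) \<notin> S \<and> (z, b) \<notin> S"
    using assms(2,3) by blast
  then show ?case using step.IH unfolding reach_avoid_def by (rule rtranclp.rtrancl_into_rtrancl[rotated])
qed

lemma reach_node: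
  assumes n: "node K v" and S: "K \<times> UNIV \<inter> S = {}" and xy: "x \<in> K \<times> UNIV" "y \<in> K \<times> UNIV"
  shows "reach_avoid (V \<times> UNIV) F S x y"
proof -
  obtain a b c d where e: "x = (a, b)" "y = (c, d)" "a \<in> K" "c \<in> K" using xy by auto
  have r: "reach_avoid (V \<times> UNIV) F S (a, b) (c, b)"
    using reach_lift[OF _ node_V[OF n] S] node_conn[OF n] e unfolding conn_def by blast
  show ?thesis
  proof (cases "d = b")
    case False
    have "c \<in> V" using node_V[OF n] e by blast
    then have "F (c, b) (c, d)" using F_rung[of c b] False by (cases b; cases d) auto
    then have "F (c, b) (c, d) \<and> (c, b) \<in> V \<times> UNIV \<and> (c, d) \<in> V \<times> UNIV \<and> (c, b) \<notin> S \<and> (c, d) \<notin> S"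
      using S e \<open>c \<in> V\<close> by blast
    then show ?thesis using r e unfolding reach_avoid_def by (simp add: rtranclp.rtrancl_into_rtrancl)
  qed (use r e in simp)
qed

context
  fixes \<kappa> :: "nat \<Rightarrow> 'a seg list"
  assumes good0: "good_path (\<kappa> 0)"
    and step: "\<And>n. \<exists>k1 k2. split_path (\<kappa> n) = Some (k1, k2) \<and> \<kappa> (Suc n) \<in> {k1, k2}"
begin

lemma good_branch: "good_path (\<kappa> n)"
proof (induction n)
  case (Suc n)
  obtain k1 k2 where "split_path (\<kappa> n) = Some (k1, k2)" "\<kappa> (Suc n) \<in> {k1, k2}" using step by blast
  then show ?case using good_split_path(1)[OF Suc, of k1 k2] by blast
qed (rule good0)

text \<open>Both halves of a path with several segments are shorter and consist of its segments, so
  a branch reaches a single segment before any expansion takes place.\<close>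

lemma branch_singleton: "\<exists>m\<ge>n. \<exists>s \<in> set (\<kappa> n). \<kappa> m = [s]"
proof (induction "length (\<kappa> n)" arbitrary: n rule: less_induct)
  case less
  obtain k1 k2 where k: "split_path (\<kappa> n) = Some (k1, k2)" "\<kappa> (Suc n) \<in> {k1, k2}" using step by blast
  show ?case
  proof (cases "\<kappa> n" rule: split_path.cases)
    case (3 s s' l)
    then have "k1 = [s]" "k2 = s' # l" using k(1) by auto
    then have "length (\<kappa> (Suc n)) < length (\<kappa> n)" "set (\<kappa> (Suc n)) \<subseteq> set (\<kappa> n)" using k(2) 3 by auto
    then obtain m s where "m \<ge> Suc n" "s \<in> set (\<kappa> n)" "\<kappa> m = [s]" using less[of "Suc n"] by blast
    then show ?thesis by (meson Suc_leD)
  qed (use k in auto)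
qed

text \<open>An infinite branch never reaches an edge, so each single segment on it has a nonempty
  expansion and lies over a node. Pieces of an expansion lie over kids of that node, so the branch
  descends the tree by one generation.\<close>

lemma branch_over:
  assumes "\<kappa> m = [s]" "over s K v"
  shows "\<exists>m' s' K' v'. m < m' \<and> \<kappa> m' = [s'] \<and> over s' K' v' \<and> (K', v') \<in> set (kids K v)"
proof -
  have v: "valid s" using good_branch[of m] assms(1) by (simp add: good_path_def)
  obtain k1 k2 where k: "split_path (\<kappa> m) = Some (k1, k2)" "\<kappa> (Suc m) \<in> {k1, k2}" using step by blast
  then have e: "expand s \<noteq> []" "set (\<kappa> (Suc m)) \<subseteq> set (expand s)"
    using assms(1) by (auto split: list.splits)
  obtain m' s' where m': "m' \<ge> Suc m" "s' \<in> set (\<kappa> (Suc m))" "\<kappa> m' = [s']"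
    using branch_singleton by blast
  have v': "valid s'" using good_branch[of m'] m'(3) by (simp add: good_path_def)
  have "expand s' \<noteq> []" using step[of m'] m'(3) by (auto split: list.splits)
  then obtain K' v' where o': "over s' K' v'" using expand_over[OF v'] by blast
  obtain K2 v2 where "over s K2 v2" "node K2 v2" "K2 \<noteq> {v2}" using expand_over[OF v e(1)] by blast
  then have "node K v" "K \<noteq> {v}" using assms(2) by (cases s; auto)+
  then have "(K', v') \<in> set (kids K v)"
    using over_expand[OF assms(2) _ o'] e(2) m'(2) kids_nonempty by blast
  then show ?thesis using m' o' by (metis Suc_le_lessD)
qed

lemma branch_nodes:
  obtains m :: "nat \<Rightarrow> nat" and s K v where
    "strict_mono m" "\<And>j. \<kappa> (m j) = [s j]" "\<And>j. over (s j) (K j) (v j)"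
    "\<And>j. (K (Suc j), v (Suc j)) \<in> set (kids (K j) (v j))"
proof -
  define P where "P x \<longleftrightarrow> \<kappa> (fst x) = [fst (snd x)] \<and>
      over (fst (snd x)) (fst (snd (snd x))) (snd (snd (snd x)))" for x :: "nat \<times> 'a seg \<times> 'a set \<times> 'a"
  define Q where "Q x y \<longleftrightarrow> fst x < fst y \<and>
      snd (snd y) \<in> set (kids (fst (snd (snd x))) (snd (snd (snd x))))" for x y :: "nat \<times> 'a seg \<times> 'a set \<times> 'a"
  obtain m0 s0 where m0: "\<kappa> m0 = [s0]" using branch_singleton by blast
  then have "valid s0" "expand s0 \<noteq> []"
    using good_branch[of m0] step[of m0] by (auto simp: good_path_def split: list.splits)
  then obtain K0 v0 where "over s0 K0 v0" using expand_over by blast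
  then have P0: "\<exists>x. P x" using m0 by (intro exI[of _ "(m0, s0, K0, v0)"]) (simp add: P_def)
  have PQ: "\<exists>y. P y \<and> Q x y" if "P x" for x
  proof -
    obtain m' s' K' v' where "fst x < m'" "\<kappa> m' = [s']" "over s' K' v'"
      "(K', v') \<in> set (kids (fst (snd (snd x))) (snd (snd (snd x))))"
      using branch_over \<open>P x\<close> unfolding P_def by blast
    then show ?thesis by (intro exI[of _ "(m', s', K', v')"]) (simp add: P_def Q_def)
  qed
  have "\<exists>f. \<forall>n. P (f n) \<and> Q (f n) (f (Suc n))"
    by (rule dependent_nat_choice) (use P0 PQ in blast)+
  then obtain f where f: "\<And>j. P (f j)" "\<And>j. Q (f j) (f (Suc j))" by blast
  show thesis
  proof (rule that[of "\<lambda>j. fst (f j)" "\<lambda>j. fst (snd (f j))" "\<lambda>j. fst (snd (snd (f j)))"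
        "\<lambda>j. snd (snd (snd (f j)))"])
    show "strict_mono (\<lambda>j. fst (f j))" unfolding strict_mono_Suc_iff using f(2) by (simp add: Q_def)
  qed (use f in \<open>simp_all add: P_def Q_def\<close>)
qed

lemma branch_path:
  "\<exists>\<rho>. ray (V \<times> UNIV) F \<rho> \<and>
     (\<forall>n. \<exists>m\<ge>n. eventually (\<lambda>i. \<rho> i \<in> interior_vs (\<kappa> m)) sequentially) \<and>
     (\<forall>S. finite S \<longrightarrow> (\<exists>n Y. Y \<inter> S = {} \<and>
        insert (path_src (\<kappa> n)) (insert (path_tgt (\<kappa> n)) (interior_vs (\<kappa> n))) \<subseteq> Y \<and>
        (\<forall>a\<in>Y. \<forall>b\<in>Y. reach_avoid (V \<times> UNIV) F S a b)))"
proof -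
  obtain m s K v where m: "strict_mono (m :: nat \<Rightarrow> nat)" and s: "\<And>j. \<kappa> (m j) = [s j]"
    and o': "\<And>j. over (s j) (K j) (v j)" and kid: "\<And>j. (K (Suc j), v (Suc j)) \<in> set (kids (K j) (v j))"
    using branch_nodes by metis
  have val: "valid (s j)" for j using good_branch[of "m j"] s[of j] by (simp add: good_path_def)
  have n: "node (K j) (v j)" for j using over_node[OF val o'] .
  have kn: "E (v j) (v (Suc j))" "K (Suc j) \<subseteq> K j - {v j}" for j
    using kids_node[OF n kid] by auto
  have dec: "K j \<subseteq> K i" if "i \<le> j" for i j
    using that by (rule lift_Suc_antimono_le[rotated]) (use kn(2) in blast)
  have vK: "v i \<in> K j" if "j \<le> i" for i j using dec[OF that] node_self[OF n] by blast
  have vn: "v j \<notin> K (Suc j)" for j using kn(2) by blast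
  have ne: "K j \<noteq> {v j}" for j using vK[of j "Suc j"] vn[of j] node_self[OF n, of "Suc j"] by auto
  let ?\<rho> = "\<lambda>i. (v i, False)"
  have "v i \<noteq> v j" if "i < j" for i j using vK[of "Suc i" j] vn[of i] that by auto
  then have "inj v" by (intro injI) (metis linorder_neqE_nat)
  then have ray: "ray (V \<times> UNIV) F ?\<rho>"
    unfolding ray_def using F_edge[OF kn(1)] subsetD[OF node_V[OF n] node_self[OF n]] by (simp add: inj_def)
  \<comment> \<open>The inner vertices of the segment may omit copies of \<open>v j\<close> and of
    the root of the last kid. That kid may be the one the branch enters, so \<open>v (Suc j)\<close>
    can be missing as well; from \<open>j + 2\<close> on the ray is inside.\<close>
  have lst: "v i \<noteq> lst (K j) (v j)" if "Suc (Suc j) \<le> i" for i j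
  proof -
    let ?q = "last (kids (K j) (v j))"
    have q: "?q \<in> set (kids (K j) (v j))" using kids_nonempty[OF n ne] by simp
    have vi: "v i \<in> K (Suc (Suc j))" "v i \<in> K (Suc j)" using vK[of _ i] that by auto
    show ?thesis
    proof (cases "?q = (K (Suc j), v (Suc j))")
      case True then show ?thesis unfolding lst_def using vi(1) vn[of "Suc j"] by auto
    next
      case False
      then have "fst ?q \<inter> K (Suc j) = {}" using kids_disjoint[OF n q kid] by simp
      moreover have "snd ?q \<in> fst ?q" using kids_node[OF n q] node_self by blast
      ultimately have "snd ?q \<notin> K (Suc j)" by (metis disjoint_iff)
      then show ?thesis unfolding lst_def using vi(2) by metis
    qed
  qed
  have int: "interior_vs (\<kappa> (m j)) = inner_vs (s j)" for j
    unfolding s by (simp add: interior_vs_def path_tgt_def cov_def)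
  have "?\<rho> i \<in> interior_vs (\<kappa> (m j))" if i: "Suc (Suc j) \<le> i" for i j
  proof -
    have "v i \<in> K j" "v i \<noteq> v j" "v i \<noteq> lst (K j) (v j)"
      using vK[of j i] vK[of "Suc j" i] vn[of j] lst[OF i] i by auto
    then show ?thesis unfolding int using o'[of j] by (cases "s j") auto
  qed
  then have ev: "eventually (\<lambda>i. ?\<rho> i \<in> interior_vs (\<kappa> (m j))) sequentially" for j
    unfolding eventually_sequentially by blast
  have "\<exists>m'\<ge>n. eventually (\<lambda>i. ?\<rho> i \<in> interior_vs (\<kappa> m')) sequentially" for n
    using ev[of n] strict_mono_imp_increasing[OF m, of n] by blast
  moreover have "\<exists>n Y. Y \<inter> S = {} \<and>
        insert (path_src (\<kappa> n)) (insert (path_tgt (\<kappa> n)) (interior_vs (\<kappa> n))) \<subseteq> Y \<and>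
        (\<forall>a\<in>Y. \<forall>b\<in>Y. reach_avoid (V \<times> UNIV) F S a b)" if S: "finite S" for S
  proof -
    \<comment> \<open>The subtrees are nested and each vertex of \<open>S\<close> leaves them
      eventually, so a late one avoids all of \<open>S\<close>; its product with \<open>UNIV\<close>
      serves as \<open>Y\<close>.\<close>
    have "\<exists>j. K j \<times> (UNIV :: bool set) \<inter> S = {}"
      using S
    proof (induction S)
      case (insert x S)
      then obtain j where j: "K j \<times> (UNIV :: bool set) \<inter> S = {}" by blast
      obtain i where "fst x \<notin> K i" using branch_escapes[of K v, OF n kid] by blast
      then have "K (max i j) \<times> (UNIV :: bool set) \<inter> insert x S = {}"
        using j dec[of i "max i j"] dec[of j "max i j"] by (cases x) auto
      then show ?case by blast
    qed simp
    then obtain j where j: "K j \<times> UNIV \<inter> S = {}" by blast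
    have sub: "insert (path_src (\<kappa> (m j))) (insert (path_tgt (\<kappa> (m j))) (interior_vs (\<kappa> (m j)))) \<subseteq> K j \<times> UNIV"
      unfolding int unfolding s path_src_def path_tgt_def
      using o'[of j] node_self[OF n, of j] lst_in(1)[OF n ne, of j] by (cases "s j") auto
    show ?thesis
      by (rule exI[of _ "m j"], rule exI[of _ "K j \<times> UNIV"], intro conjI ballI j sub reach_node[OF n j])
  qed
  ultimately show ?thesis using ray by blast
qed

end

section \<open>The product graph and the closed path at the root\<close>

lemma graph_F: "graph (V \<times> UNIV) F"
  unfolding graph_def
proof (intro allI impI)
  fix x y assume F: "F x y"
  then show "x \<in> V \<times> UNIV \<and> y \<in> V \<times> UNIV \<and> x \<noteq> y \<and> F y x"
    using F_sym[OF F] E_V by (cases x; cases y) (auto simp: box_K2_def graph_square_def)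
qed

lemma locally_finite_F: "locally_finite (V \<times> UNIV) F"
  unfolding locally_finite_def using finite_F_nbrs by blast

text \<open>The whole graph is a node with empty boundary. Its \<open>Rung\<close> leads from one
  copy of \<open>r\<close> to the other, and the edge between the copies closes it to a loop at
  \<open>(r, False)\<close>.\<close>

lemma root_path:
  assumes r: "r \<in> V"
  shows "good_path [Rung V r False, Edge (r, True) (r, False)]"
    "interior_vs [Rung V r False, Edge (r, True) (r, False)] = V \<times> UNIV - {(r, False)}"
proof -
  have "conn V" using connected unfolding conn_def connected_graph_def adj_def[abs_def] by blast
  moreover have "finite {(x, y). E x y \<and> x \<in> V \<and> y \<notin> V}"
    by (rule finite_subset[of _ "{}"]) (use E_V in auto)
  ultimately have n: "node V r" using r unfolding node_def by simp
  show i: "interior_vs [Rung V r False, Edge (r, True) (r, False)] = V \<times> UNIV - {(r, False)}"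
    using r by (auto simp: interior_vs_def path_tgt_def cov_def)
  have "F (r, True) (r, False)" using F_rung[OF r, of True] by simp
  then show "good_path [Rung V r False, Edge (r, True) (r, False)]"
    using n unfolding good_path_def i by (auto simp: path_src_def path_tgt_def cov_def)
qed

end

theorem theorem11:
  fixes V :: "'a set" and E :: "'a \<Rightarrow> 'a \<Rightarrow> bool"
  assumes "graph V E" and "infinite V" and "locally_finite V E" and "connected_graph V E"
  shows "\<exists>C. hamiltonian_circle (V \<times> (UNIV :: bool set)) (box_K2 V (graph_square E)) C"
proof -
  interpret infinite_graph V E by unfold_locales (fact assms)+
  interpret subdivision "V \<times> UNIV" F split_path path_src path_tgt interior_vs good_path
  proof unfold_locales
    show "graph (V \<times> UNIV) F" by (rule graph_F)
    show "Defs.locally_finite (V \<times> UNIV) F" by (rule locally_finite_F)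
  next
    fix k k1 k2 assume "good_path k" "split_path k = Some (k1, k2)"
    note good_split_path[OF this]
    then show "good_path k1 \<and> good_path k2 \<and> path_src k1 = path_src k \<and> path_src k2 = path_tgt k1 \<and>
        path_tgt k2 = path_tgt k"
      "interior_vs k = insert (path_tgt k1) (interior_vs k1 \<union> interior_vs k2) \<and>
        interior_vs k1 \<inter> interior_vs k2 = {} \<and> path_tgt k1 \<notin> interior_vs k1 \<union> interior_vs k2"
      by simp_all
  qed (fact good_leaf_path good_path_ends left_terminates_path right_terminates_path
      finite_boundary_path branch_path)+
  have "V \<noteq> {}" using assms(2) by (rule infinite_imp_nonempty)
  then obtain r where r: "r \<in> V" by (meson ex_in_conv)
  let ?root = "[Rung V r False, Edge (r, True) (r, False)]"
  \<comment> \<open>Infinity rules out the degenerate loop with a single inner vertex.\<close>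
  have "infinite (V \<times> (UNIV :: bool set))" using assms(2) r by (auto simp: finite_cartesian_product_iff)
  then have "interior_vs ?root \<noteq> {x}" for x
    unfolding root_path(2)[OF r] by (metis finite.emptyI finite.insertI finite_Diff2)
  moreover have "insert (path_src ?root) (interior_vs ?root) = V \<times> UNIV"
    unfolding root_path(2)[OF r] using r by (auto simp: path_src_def)
  ultimately show ?thesis
    by (intro hamiltonian_circle_curve[OF root_path(1)[OF r]]) (simp_all add: path_src_def path_tgt_def)
qed

end
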